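(* Let $n$ be an odd positive integer and put $m:=(n-1)/2$. Assume that the complex Morris constant term identity holds for $n$, that is, assume that there exists a polynomial $P_n(x)$, with $P_n(0)=1/(n-2)!!$ and $P_n(1)=1$, such that for all nonnegative integers $a,b$ and all $u\in\mathbb{C}$ with $\mathrm{Re}(1+\tfrac12 nu)>0$, \[ \mathrm{CT}\bigg[\prod_{i=1}^n (1-x_i)^a\Big(1-\frac{1}{x_i}\Big)^b \prod_{1\leq i<j\leq n}\Big(1-\Big(\frac{x_i}{x_j}\Big)^{\tau_{ij}}\Big)^u\bigg] = x^m P_n(x^2)\,\frac{\Gamma(1+\frac12 nu)}{\Gamma(1+\frac12 u)^n}\prod_{i=0}^{n-1}\frac{(1+\frac12 iu)_{a+b}}{(1+\frac12 iu)_a(1+\frac12 iu)_b}, \] where $x=x(u):=\cos(\tfrac12\pi u)$ (and $P_n$ does not depend on $a$, $b$). Let $k$ be a nonnegative integer and $K:=2k+1$. Then for all nonnegative integers $a,b$, \[ \mathrm{CT}\bigg[\Delta(X)\prod_{i=1}^n x_i^{-m}(1-x_i)^a\Big(1-\frac1{x_i}\Big)^b\prod_{i=1}^m\log\Big(1-\frac{x_{2i}}{x_{2i-1}}\Big)\prod_{1\leq i\neq j\leq n}\Big(1-\frac{x_i}{x_j}\Big)^k\bigg] =\frac{1}{n!!}\prod_{i=0}^{n-1}\frac{(2a+2b+iK)!!\,((i+1)K)!!}{(2a+iK)!!\,(2b+iK)!!\,K!!}. \]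
   Context: $\mathrm{CT}\,f(X)$ denotes the constant term (coefficient of $x_1^0\cdots x_n^0$) of the Laurent polynomial or Laurent series $f(X)=f(x_1,\dots,x_n)$. $\Delta(X)=\prod_{1\le i<j\le n}(x_i-x_j)$. $(c)_N=c(c+1)\cdots(c+N-1)$ is the Pochhammer symbol. $N!!$ is the double factorial, with $0!!=(-1)!!=1$. For $1\le i<j\le n$ the signatures are $\tau_{ij}=1$ if $j\le m+i$ and $\tau_{ij}=-1$ if $j>m+i$. Powers and logarithms are expanded as power series: $(1-z)^u=\sum_{N\ge0}(-z)^N\binom{u}{N}$ with $\binom{u}{N}=(-1)^N(-u)_N/N!$, and $\log(1-z)=-\sum_{N\ge1}z^N/N$. Here $z$ is the displayed monomial, e.g. $z=(x_i/x_j)^{\tau_{ij}}$ or $z=x_{2i}/x_{2i-1}$. In the identity containing the logarithms the constant term is a finite sum. In the identity containing complex $u$ the constant term is the sum of the multiple series obtained by expanding every factor and collecting all terms whose monomial is $1$; this series converges absolutely for $\mathrm{Re}(u)>0$. When it does not converge absolutely it is read as an Abel sum: replace each $(x_i/x_j)^{\tau_{ij}}$ by $r(x_i/x_j)^{\tau_{ij}}$ with $0<r<1$ and let $r\to1^-$. *)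

theory Defs
  imports "HOL-Analysis.Analysis" "HOL-Library.Poly_Mapping"
begin

text \<open>Laurent polynomials over \<^typ>\<open>complex\<close> in variables indexed by \<^typ>\<open>nat\<close>: finitely
  supported maps from exponent vectors (finitely supported, integer valued) to coefficients.
  The library's multiplication on \<^typ>\<open>'a \<Rightarrow>\<^sub>0 'b\<close> is convolution, as required.\<close>

type_synonym laurent = "(nat \<Rightarrow>\<^sub>0 int) \<Rightarrow>\<^sub>0 complex"

definition xpow :: "nat \<Rightarrow> int \<Rightarrow> laurent" where
  "xpow i e = Poly_Mapping.single (Poly_Mapping.single i e) 1"

definition CT :: "laurent \<Rightarrow> complex" where
  "CT f = Poly_Mapping.lookup f 0"

definition pairs :: "nat \<Rightarrow> (nat \<times> nat) set" where
  "pairs n = {(i, j). 1 \<le> i \<and> i < j \<and> j \<le> n}"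

definition vandermonde :: "nat \<Rightarrow> laurent" where
  "vandermonde n = (\<Prod>(i, j)\<in>pairs n. xpow i 1 - xpow j 1)"

definition sig :: "nat \<Rightarrow> nat \<Rightarrow> nat \<Rightarrow> int" where
  "sig m i j = (if j \<le> m + i then 1 else - 1)"

text \<open>The integer argument makes \<open>(-1)!! = 1\<close> available, as an empty product.\<close>

definition dfact :: "int \<Rightarrow> int" where
  "dfact N = (\<Prod>l | l \<in> {1..N} \<and> even (N - l). l)"

text \<open>The expansions of \<open>(1 - z)\<^sup>u\<close> and \<open>log (1 - z)\<close> in powers of \<open>z\<close>.\<close>

definition one_minus_powr :: "complex \<Rightarrow> complex fps" where
  "one_minus_powr u = Abs_fps (\<lambda>N. (- 1) ^ N * (u gchoose N))"

definition log_one_minus :: "complex fps" where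
  "log_one_minus = Abs_fps (\<lambda>N. if N = 0 then 0 else - 1 / of_nat N)"

text \<open>Let \<open>L\<close> be a Laurent polynomial and, for \<open>s\<close> in a finite set \<open>S\<close>, let \<open>F s\<close> be a power
  series and \<open>z s\<close> a Laurent monomial. Expanding every \<open>F s\<close> in
  \<open>L * (\<Prod>s\<in>S. F s (z s))\<close> gives a multiple series over the functions \<open>N\<close> in
  \<open>S \<rightarrow>\<^sub>E UNIV\<close>; its \<open>N\<close>-th term contributes \<open>ct_term L S F z N\<close> to the constant term.\<close>

definition ct_term ::
  "laurent \<Rightarrow> 's set \<Rightarrow> ('s \<Rightarrow> complex fps) \<Rightarrow> ('s \<Rightarrow> laurent) \<Rightarrow> ('s \<Rightarrow> nat) \<Rightarrow> complex" where
  "ct_term L S F z N = (\<Prod>s\<in>S. fps_nth (F s) (N s)) * CT (L * (\<Prod>s\<in>S. z s ^ N s))"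

text \<open>Plain (unordered) summation. For complex terms this is the same as absolute convergence,
  and it includes the case of finitely many nonzero terms.\<close>

definition has_CT_sum ::
  "laurent \<Rightarrow> 's set \<Rightarrow> ('s \<Rightarrow> complex fps) \<Rightarrow> ('s \<Rightarrow> laurent) \<Rightarrow> complex \<Rightarrow> bool" where
  "has_CT_sum L S F z v \<longleftrightarrow> (ct_term L S F z has_sum v) (S \<rightarrow>\<^sub>E UNIV)"

text \<open>Abel summation: replacing every \<open>z s\<close> by \<open>r * z s\<close> multiplies the \<open>N\<close>-th term by
  \<open>r ^ (\<Sum>s\<in>S. N s)\<close>.\<close>

definition abel_term ::
  "laurent \<Rightarrow> 's set \<Rightarrow> ('s \<Rightarrow> complex fps) \<Rightarrow> ('s \<Rightarrow> laurent) \<Rightarrow> real \<Rightarrow> ('s \<Rightarrow> nat) \<Rightarrow> complex" where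
  "abel_term L S F z r N = of_real r ^ (\<Sum>s\<in>S. N s) * ct_term L S F z N"

definition has_CT_Abel ::
  "laurent \<Rightarrow> 's set \<Rightarrow> ('s \<Rightarrow> complex fps) \<Rightarrow> ('s \<Rightarrow> laurent) \<Rightarrow> complex \<Rightarrow> bool" where
  "has_CT_Abel L S F z v \<longleftrightarrow>
     (\<forall>r\<in>{0<..<1}. (\<lambda>N. norm (abel_term L S F z r N)) summable_on (S \<rightarrow>\<^sub>E UNIV)) \<and>
     ((\<lambda>r. infsum (abel_term L S F z r) (S \<rightarrow>\<^sub>E UNIV)) \<longlongrightarrow> v) (at_left 1)"

definition has_CT ::
  "laurent \<Rightarrow> 's set \<Rightarrow> ('s \<Rightarrow> complex fps) \<Rightarrow> ('s \<Rightarrow> laurent) \<Rightarrow> complex \<Rightarrow> bool" where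
  "has_CT L S F z v \<longleftrightarrow>
     (if (\<lambda>N. norm (ct_term L S F z N)) summable_on (S \<rightarrow>\<^sub>E UNIV)
      then has_CT_sum L S F z v else has_CT_Abel L S F z v)"

definition morris_factor :: "nat \<Rightarrow> nat \<Rightarrow> nat \<Rightarrow> laurent" where
  "morris_factor n a b = (\<Prod>i=1..n. (1 - xpow i 1) ^ a * (1 - xpow i (- 1)) ^ b)"

definition complex_morris :: "nat \<Rightarrow> nat \<Rightarrow> complex poly \<Rightarrow> bool" where
  "complex_morris n m P \<longleftrightarrow>
     (\<forall>a b u. Re (1 + of_nat n * u / 2) > 0 \<longrightarrow>
       has_CT (morris_factor n a b) (pairs n) (\<lambda>_. one_minus_powr u)
         (\<lambda>(i, j). xpow i (sig m i j) * xpow j (- sig m i j))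
         (cos (of_real pi * u / 2) ^ m * poly P ((cos (of_real pi * u / 2))\<^sup>2) *
          (Gamma (1 + of_nat n * u / 2) / Gamma (1 + u / 2) ^ n) *
          (\<Prod>i<n. pochhammer (1 + of_nat i * u / 2) (a + b) /
             (pochhammer (1 + of_nat i * u / 2) a * pochhammer (1 + of_nat i * u / 2) b))))"

end

theory Submission imports Defs
begin

text \<open>
  Take \<open>u = K + e\<close> in the complex Morris identity and let the real number \<open>e\<close> tend to \<open>0\<close> from
  above; both sides vanish to order \<open>m\<close>, and the result compares the leading coefficients. On the left, the
  factors \<open>(1 - z)\<^sup>K\<close> combine, up to sign, with the Morris factor into the Laurent polynomial \<open>W\<close> of the
  logarithmic identity, and only the factors \<open>(1 - z)\<^sup>e\<close> are expanded. Group the terms by the set \<open>E\<close>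
  of pairs whose exponent is nonzero, regarded as a graph on the \<open>n = 2 m + 1\<close> variables. Since \<open>W\<close> is
  antisymmetric, \<open>E\<close> contributes nothing if it misses two vertices. If \<open>E\<close> is a matching with \<open>m\<close>
  edges, its contribution is asymptotic to \<open>e\<^sup>m\<close> times the constant term with logarithms on the edges of
  \<open>E\<close>. Otherwise \<open>E\<close> contains a forest with more than \<open>m\<close> edges; the exponents on the forest are
  determined by the others up to finitely many choices, and each of their coefficients is \<open>O(e)\<close>, so the
  contribution is \<open>O(e\<^bsup>m+1\<^esup>)\<close>.

  The sum over the near-perfect matchings is \<open>n\<close> times its part with a fixed missing vertex, by cyclic
  symmetry, and in that part all but one matching cancel.
\<close>

section \<open>Permuting variables in Laurent polynomials\<close>

text \<open>The obstacle is uniformity in \<open>e\<close>. Each coefficient of (1 - z)^e beyond the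
  constant one is O(e), but for 0 < e < 1 their absolute values add up to 1, so a support
  \<open>E\<close> with many arcs need not contribute O(e^|E|). What helps is that \<open>W\<close>
  has only finitely many monomials: once the exponent vector is fixed, the exponents on a forest
  follow from the other ones. A forest arc thus costs a single coefficient, of size at most
  \<open>e\<close>, and any other arc a whole sum, of size at most 2. The range 0 < e < 1 also gives
  absolute convergence, so the Morris constant term is a plain sum there and no Abel limit enters.

  On the closed form side, the order \<open>m\<close> of vanishing comes from the simple zero of
  cos(pi u / 2) at the odd number \<open>K\<close>. The factor \<open>n\<close> counting the
  possible missing vertices turns P(0) = 1/(n-2)!! into 1/n!!. That \<open>n\<close> is odd makes
  the tournament of expansion directions regular and the cyclic rotation an even
  permutation.\<close>

definition arcmon :: "nat \<times> nat \<Rightarrow> laurent" where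
  "arcmon s = xpow (fst s) 1 * xpow (snd s) (- 1)"

definition arcvec :: "nat \<times> nat \<Rightarrow> (nat \<Rightarrow>\<^sub>0 int)" where
  "arcvec s = Poly_Mapping.single (fst s) 1 + Poly_Mapping.single (snd s) (- 1)"

text \<open>\<open>map_key\<close> precomposes: the coefficient of the result at v is that of
  \<open>f\<close> at v o pi. With this convention x_i is sent to x_(pi i), without an
  inverse.\<close>

definition permute_vars :: "(nat \<Rightarrow> nat) \<Rightarrow> laurent \<Rightarrow> laurent" where
  "permute_vars \<pi> f = Poly_Mapping.map_key (Poly_Mapping.map_key \<pi>) f"

lemma inj_map_key:
  assumes "bij \<pi>"
  shows "inj (Poly_Mapping.map_key \<pi> :: ('a \<Rightarrow>\<^sub>0 'b::zero) \<Rightarrow> _)"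
proof (rule injI)
  fix p q :: "'a \<Rightarrow>\<^sub>0 'b"
  assume "Poly_Mapping.map_key \<pi> p = Poly_Mapping.map_key \<pi> q"
  then have "Poly_Mapping.lookup p (\<pi> x) = Poly_Mapping.lookup q (\<pi> x)" for x
    using bij_is_inj[OF assms] by (metis comp_apply map_key.rep_eq)
  then show "p = q"
    by (metis assms bij_pointE poly_mapping_eqI)
qed

lemma permute_vars_add: "bij \<pi> \<Longrightarrow> permute_vars \<pi> (f + g) = permute_vars \<pi> f + permute_vars \<pi> g"
  by (simp add: permute_vars_def inj_map_key map_key_plus)

lemma CT_permute_vars: "bij \<pi> \<Longrightarrow> CT (permute_vars \<pi> f) = CT f"
  by (simp add: permute_vars_def CT_def map_key.rep_eq inj_map_key map_key_zero bij_is_inj)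

lemma permute_vars_single:
  assumes "bij \<pi>"
  shows "permute_vars \<pi> (Poly_Mapping.single v c) = Poly_Mapping.single (Poly_Mapping.map_key (inv \<pi>) v) c"
proof -
  have inj: "inj \<pi>" "inj (inv \<pi>)"
    using assms by (auto simp: bij_is_inj bij_imp_bij_inv)
  have "Poly_Mapping.map_key \<pi> (Poly_Mapping.map_key (inv \<pi>) v) = v"
    using inj by (simp add: map_key_compose map_key_id[folded id_def])
  then show ?thesis
    unfolding permute_vars_def using inj_map_key[OF assms] map_key_single by metis
qed

lemma poly_mapping_add_induct [case_names zero add]:
  fixes f :: "'a \<Rightarrow>\<^sub>0 'b::monoid_add"
  assumes "P 0" and "\<And>f v c. P f \<Longrightarrow> P (f + Poly_Mapping.single v c)"
  shows "P f"
proof (induction f rule: update_induct)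
  case const then show ?case using assms(1) by simp
next
  case (update f a b)
  have "Poly_Mapping.update a b f = f + Poly_Mapping.single a b"
    by (rule poly_mapping_eqI)
      (use update in \<open>auto simp: lookup_update lookup_add lookup_single in_keys_iff when_def\<close>)
  then show ?case using assms(2) update by simp
qed

text \<open>Both sides are additive in \<open>f\<close> and in \<open>g\<close>, which leaves
  monomials, where the claim is additivity of \<open>map_key\<close> on exponent vectors.\<close>

lemma permute_vars_mult:
  assumes "bij \<pi>"
  shows "permute_vars \<pi> (f * g) = permute_vars \<pi> f * permute_vars \<pi> g"
proof -
  have z: "permute_vars \<pi> 0 = 0"
    by (simp add: permute_vars_def inj_map_key assms)
  have i: "inj (inv \<pi>)" using assms by (simp add: bij_is_inj bij_imp_bij_inv)
  have 1: "permute_vars \<pi> (Poly_Mapping.single v c * g) = permute_vars \<pi> (Poly_Mapping.single v c) * permute_vars \<pi> g" for v c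
    by (induction g rule: poly_mapping_add_induct)
      (simp_all add: z permute_vars_add assms distrib_left mult_single permute_vars_single map_key_plus i)
  show ?thesis
    by (induction f rule: poly_mapping_add_induct)
      (simp_all add: z permute_vars_add assms distrib_right 1)
qed

lemma permute_vars_xpow:
  assumes "bij \<pi>"
  shows "permute_vars \<pi> (xpow i e) = xpow (\<pi> i) e"
proof -
  have "Poly_Mapping.map_key (inv \<pi>) (Poly_Mapping.single i e) = Poly_Mapping.single (\<pi> i) e"
    using assms bij_imp_bij_inv[OF assms]
    by (metis bij_inv_eq_iff bij_is_inj map_key_single)
  then show ?thesis by (simp add: xpow_def permute_vars_single assms)
qed

lemma permute_vars_one: "bij \<pi> \<Longrightarrow> permute_vars \<pi> 1 = 1"
  using permute_vars_xpow[of \<pi> _ 0] by (simp add: xpow_def)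

lemma permute_vars_diff: "bij \<pi> \<Longrightarrow> permute_vars \<pi> (f - g) = permute_vars \<pi> f - permute_vars \<pi> g"
  by (metis permute_vars_add add_diff_cancel_right' diff_add_cancel)

lemma permute_vars_power: "bij \<pi> \<Longrightarrow> permute_vars \<pi> (f ^ N) = permute_vars \<pi> f ^ N"
  by (induction N) (simp_all add: permute_vars_one permute_vars_mult)

lemma permute_vars_prod: "bij \<pi> \<Longrightarrow> permute_vars \<pi> (prod f A) = (\<Prod>x\<in>A. permute_vars \<pi> (f x))"
  by (induction A rule: infinite_finite_induct) (simp_all add: permute_vars_one permute_vars_mult)

lemma permute_vars_arcmon: "bij \<pi> \<Longrightarrow> permute_vars \<pi> (arcmon s) = arcmon (map_prod \<pi> \<pi> s)"
  by (simp add: arcmon_def permute_vars_mult permute_vars_xpow)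

section \<open>Monomials attached to arcs and their exponent vectors\<close>

lemma xpow_add: "xpow i d * xpow i e = xpow i (d + e)"
  by (simp add: xpow_def mult_single single_add)

lemma xpow_0 [simp]: "xpow i 0 = 1"
  by (simp add: xpow_def)

lemma xpow_power: "xpow i d ^ N = xpow i (int N * d)"
  by (induction N) (simp_all add: xpow_add algebra_simps)


lemma arcmon_eq: "arcmon s = Poly_Mapping.single (arcvec s) 1"
  by (simp add: arcmon_def xpow_def arcvec_def mult_single)

definition arc_exponent :: "(nat \<times> nat) set \<Rightarrow> (nat \<times> nat \<Rightarrow> nat) \<Rightarrow> (nat \<Rightarrow>\<^sub>0 int)" where
  "arc_exponent A M = (\<Sum>s\<in>A. frag_cmul (int (M s)) (arcvec s))"

lemma arcmon_power: "arcmon s ^ N = Poly_Mapping.single (frag_cmul (int N) (arcvec s)) 1"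
  by (induction N) (simp_all add: arcmon_eq mult_single frag_cmul_distrib)

lemma prod_arcmon_power: "(\<Prod>s\<in>A. arcmon s ^ M s) = Poly_Mapping.single (arc_exponent A M) 1"
  by (induction A rule: infinite_finite_induct) (simp_all add: arc_exponent_def arcmon_power mult_single)

lemma CT_times_single: "CT (W * Poly_Mapping.single v c) = Poly_Mapping.lookup W (- v) * c"
proof (induction W rule: poly_mapping_add_induct)
  case zero then show ?case by (simp add: CT_def)
next
  case (add f w d)
  have "w + v = 0 \<longleftrightarrow> w = - v" by (simp add: add_eq_0_iff2)
  then show ?case using add
    by (auto simp: distrib_right CT_def lookup_add mult_single lookup_single when_def)
qed

lemma ct_term_arcmon:
  "ct_term W A F arcmon M = (\<Prod>s\<in>A. fps_nth (F s) (M s)) * Poly_Mapping.lookup W (- arc_exponent A M)"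
  by (simp add: ct_term_def prod_arcmon_power CT_times_single)

lemma lookup_arcvec:
  "Poly_Mapping.lookup (arcvec s) v = (if fst s = v then 1 else 0) - (if snd s = v then 1 else 0)"
  by (auto simp: arcvec_def lookup_add lookup_single)

lemma lookup_arc_exponent:
  "Poly_Mapping.lookup (arc_exponent A M) v = (\<Sum>s\<in>A. int (M s) * Poly_Mapping.lookup (arcvec s) v)"
  by (induction A rule: infinite_finite_induct) (simp_all add: arc_exponent_def lookup_add)

text \<open>The sign of the permutation, written as a product over pairs because permuting the
  factors of the Vandermonde product yields it in this form. Its values needed later are found by
  counting inversions.\<close>

definition inversion_sign :: "nat \<Rightarrow> (nat \<Rightarrow> nat) \<Rightarrow> int" where
  "inversion_sign n \<pi> = (\<Prod>(i, j)\<in>pairs n. if \<pi> i < \<pi> j then 1 else - 1)"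

lemma finite_pairs [simp]: "finite (pairs n)"
  by (rule finite_subset[of _ "{..n} \<times> {..n}"]) (auto simp: pairs_def)

lemma inversion_sign_eq: "inversion_sign n \<pi> = (- 1) ^ card {(i, j) \<in> pairs n. \<not> \<pi> i < \<pi> j}"
proof -
  have "inversion_sign n \<pi> = (\<Prod>s\<in>pairs n. if \<not> \<pi> (fst s) < \<pi> (snd s) then - 1 else 1)"
    unfolding inversion_sign_def by (intro prod.cong) auto
  also have "\<dots> = (- 1) ^ card (pairs n \<inter> {s. \<not> \<pi> (fst s) < \<pi> (snd s)})"
    by (simp flip: prod.inter_restrict add: prod.If_cases)
  also have "pairs n \<inter> {s. \<not> \<pi> (fst s) < \<pi> (snd s)} = {(i, j) \<in> pairs n. \<not> \<pi> i < \<pi> j}"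
    by auto
  finally show ?thesis .
qed

lemma inversion_sign_square: "inversion_sign n \<pi> * inversion_sign n \<pi> = 1"
  by (simp add: inversion_sign_eq flip: power_add)

text \<open>The inversions are (p, q) itself and, for each r strictly between, (p, r) and (r, q): an
  odd number.\<close>

lemma inversion_sign_transpose:
  assumes "p \<in> {1..n}" "q \<in> {1..n}" "p < q"
  shows "inversion_sign n (Transposition.transpose p q) = - 1"
proof -
  have "{(i, j) \<in> pairs n. \<not> Transposition.transpose p q i < Transposition.transpose p q j} =
      insert (p, q) ({p} \<times> {p<..<q} \<union> {p<..<q} \<times> {q})"
    using assms by (auto simp: pairs_def Transposition.transpose_def split: if_splits)
  moreover have "card (insert (p, q) ({p} \<times> {p<..<q} \<union> {p<..<q} \<times> {q})) = Suc (2 * (q - Suc p))"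
    by (subst card_insert_disjoint, simp, force, subst card_Un_disjoint) (auto simp: card_cartesian_product)
  ultimately show ?thesis by (simp add: inversion_sign_eq)
qed

lemma permute_vars_vandermonde:
  assumes "\<pi> permutes {1..n}"
  shows "permute_vars \<pi> (vandermonde n) = of_int (inversion_sign n \<pi>) * vandermonde n"
proof -
  have bij: "bij \<pi>" using assms by (rule permutes_bij)
  \<comment> \<open>\<open>g\<close> takes a pair to its image in increasing order, each reordering
    costing the factor -1 recorded by \<open>inversion_sign\<close>; \<open>h\<close> does the same
    for the inverse permutation and undoes \<open>g\<close>.\<close>
  define g where "g = (\<lambda>(i, j). if \<pi> i < \<pi> j then (\<pi> i, \<pi> j) else (\<pi> j, \<pi> i))"
  define h where "h = (\<lambda>(i, j). if inv \<pi> i < inv \<pi> j then (inv \<pi> i, inv \<pi> j) else (inv \<pi> j, inv \<pi> i))"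
  let ?v = "\<lambda>(i, j). xpow i 1 - xpow j 1 :: laurent"
  have inv: "inv \<pi> permutes {1..n}" using assms by (rule permutes_inv)
  have inj: "\<pi> i = \<pi> j \<longleftrightarrow> i = j" "inv \<pi> i = inv \<pi> j \<longleftrightarrow> i = j" for i j
    using assms inv by (meson injD permutes_inj)+
  have cancel: "\<pi> (inv \<pi> i) = i" "inv \<pi> (\<pi> i) = i" for i
    using assms by (simp_all add: permutes_inverses)
  have mem: "1 \<le> \<pi> i \<and> \<pi> i \<le> n" "1 \<le> inv \<pi> i \<and> inv \<pi> i \<le> n" if "1 \<le> i" "i \<le> n" for i
    using permutes_in_image[OF assms, of i] permutes_in_image[OF inv, of i] that by auto
  have "permute_vars \<pi> (vandermonde n) = (\<Prod>(i, j)\<in>pairs n. xpow (\<pi> i) 1 - xpow (\<pi> j) 1)"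
    by (simp add: vandermonde_def permute_vars_prod bij case_prod_beta permute_vars_diff permute_vars_xpow)
  also have "\<dots> = (\<Prod>s\<in>pairs n. of_int (case s of (i, j) \<Rightarrow> if \<pi> i < \<pi> j then 1 else - 1) * ?v (g s))"
    by (intro prod.cong) (auto simp: g_def)
  also have "\<dots> = of_int (inversion_sign n \<pi>) * (\<Prod>s\<in>pairs n. ?v (g s))"
    by (simp add: prod.distrib inversion_sign_def)
  also have "(\<Prod>s\<in>pairs n. ?v (g s)) = (\<Prod>s\<in>pairs n. ?v s)"
  proof (rule prod.reindex_bij_witness[of _ h g])
    fix s assume s: "s \<in> pairs n"
    obtain i j where [simp]: "s = (i, j)" by force
    have *: "i < j" "1 \<le> i" "i \<le> n" "1 \<le> j" "j \<le> n" using s by (auto simp: pairs_def)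
    then have n: "\<pi> i \<noteq> \<pi> j" "inv \<pi> i \<noteq> inv \<pi> j" by (simp_all add: inj)
    have "h (g s) = s"
      using * by (simp add: g_def h_def cancel)
    moreover have "g (h s) = s"
      using * by (simp add: g_def h_def cancel)
    moreover have "g s \<in> pairs n"
      using n mem(1)[of i] mem(1)[of j] * by (simp add: g_def pairs_def)
    moreover have "h s \<in> pairs n"
      using n mem(2)[of i] mem(2)[of j] * by (simp add: h_def pairs_def)
    ultimately show "h (g s) = s" "g s \<in> pairs n" "g (h s) = s" "h s \<in> pairs n"
      by auto
  qed simp
  finally show ?thesis by (simp add: vandermonde_def)
qed

text \<open>The polynomial \<open>W\<close> of the overview, in the form in which the final theorem
  displays it, so that unfolding suffices at the end.\<close>

definition logW :: "nat \<Rightarrow> nat \<Rightarrow> nat \<Rightarrow> nat \<Rightarrow> nat \<Rightarrow> laurent" where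
  "logW n m k a b = vandermonde n *
            (\<Prod>i=1..n. xpow i (- int m) * (1 - xpow i 1) ^ a * (1 - xpow i (- 1)) ^ b) *
            (\<Prod>(i, j) | i \<in> {1..n} \<and> j \<in> {1..n} \<and> i \<noteq> j. (1 - xpow i 1 * xpow j (- 1)) ^ k)"

text \<open>The Vandermonde product supplies the sign; the other two products are symmetric, since a
  permutation only reorders their factors.\<close>

lemma permute_vars_logW:
  assumes "\<pi> permutes {1..n}"
  shows "permute_vars \<pi> (logW n m k a b) = of_int (inversion_sign n \<pi>) * logW n m k a b"
proof -
  have bij: "bij \<pi>" using assms by (rule permutes_bij)
  have 1: "permute_vars \<pi> (\<Prod>i=1..n. xpow i (- int m) * (1 - xpow i 1) ^ a * (1 - xpow i (- 1)) ^ b) =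
      (\<Prod>i=1..n. xpow i (- int m) * (1 - xpow i 1) ^ a * (1 - xpow i (- 1)) ^ b)" (is "permute_vars \<pi> (prod ?f _) = _")
  proof -
    have "permute_vars \<pi> (prod ?f {1..n}) = (\<Prod>i=1..n. ?f (\<pi> i))"
      using bij by (simp add: permute_vars_prod permute_vars_mult permute_vars_power permute_vars_diff permute_vars_one permute_vars_xpow)
    also have "\<dots> = prod ?f {1..n}"
      using prod.permute[OF assms, of ?f] by (simp add: o_def)
    finally show ?thesis .
  qed
  let ?Q = "{(i, j). i \<in> {1..n} \<and> j \<in> {1..n} \<and> i \<noteq> j}"
  let ?g = "\<lambda>(i, j). (1 - xpow i 1 * xpow j (- 1)) ^ k :: laurent"
  have 2: "permute_vars \<pi> (prod ?g ?Q) = prod ?g ?Q"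
  proof -
    have "permute_vars \<pi> (prod ?g ?Q) = (\<Prod>s\<in>?Q. ?g (map_prod \<pi> \<pi> s))"
      using bij by (simp add: permute_vars_prod case_prod_beta permute_vars_mult permute_vars_power permute_vars_diff permute_vars_one permute_vars_xpow)
    also have "\<dots> = prod ?g ?Q"
    proof (rule prod.reindex_bij_betw)
      have inj: "inj_on (map_prod \<pi> \<pi>) ?Q"
        by (intro inj_on_subset[OF prod.inj_map]) (simp_all add: bij bij_is_inj)
      have "map_prod \<pi> \<pi> ` ?Q \<subseteq> ?Q"
        using permutes_in_image[OF assms] permutes_inj[OF assms] by (auto dest: injD)
      moreover have "finite ?Q"
        by (rule finite_subset[of _ "{..n} \<times> {..n}"]) auto
      ultimately show "bij_betw (map_prod \<pi> \<pi>) ?Q ?Q"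
        using inj by (simp add: bij_betw_def endo_inj_surj)
    qed
    finally show ?thesis .
  qed
  show ?thesis
    unfolding logW_def using bij 1 2 permute_vars_vandermonde[OF assms] by (simp add: permute_vars_mult mult.assoc)
qed

section \<open>Expansions at a shifted exponent\<close>

lemma has_sum_sum_finite:
  fixes f :: "'i \<Rightarrow> 'a \<Rightarrow> complex"
  assumes "finite I" "\<And>i. i \<in> I \<Longrightarrow> (f i has_sum S i) X"
  shows "((\<lambda>x. \<Sum>i\<in>I. f i x) has_sum (\<Sum>i\<in>I. S i)) X"
  using assms by (induction I rule: finite_induct) (auto intro: has_sum_add)

lemma CT_add: "CT (f + g) = CT f + CT g"
  by (simp add: CT_def lookup_add)

lemma CT_sum: "CT (sum f A) = (\<Sum>x\<in>A. CT (f x))"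
  by (induction A rule: infinite_finite_induct) (simp_all add: CT_add, simp_all add: CT_def)

lemma CT_of_int_mult: "CT (of_int c * f) = of_int c * CT f"
  using CT_times_single[of f 0 "of_int c"] by (simp add: CT_def mult.commute)

text \<open>Vandermonde convolution, that is (1 - z)^(K+u) = (1 - z)^K (1 - z)^u. The guard
  \<open>j \<le> N\<close> makes the range of \<open>j\<close> independent of \<open>N\<close>, so
  that products of such sums expand over one finite set of choices.\<close>

lemma one_minus_powr_shift:
  "fps_nth (one_minus_powr (of_nat K + u)) N =
    (\<Sum>j\<le>K. if j \<le> N then of_int ((- 1) ^ j * int (K choose j)) * fps_nth (one_minus_powr u) (N - j) else 0)"
    (is "_ = (\<Sum>j\<le>K. ?f j)")
proof -
  have "fps_nth (one_minus_powr (of_nat K + u)) N =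
     (- 1) ^ N * (\<Sum>j\<le>N. (of_nat K gchoose j) * (u gchoose (N - j)))"
    by (simp add: one_minus_powr_def gbinomial_Vandermonde flip: atLeast0AtMost)
  also have "\<dots> = (\<Sum>j\<le>N. of_int ((- 1) ^ j * int (K choose j)) * fps_nth (one_minus_powr u) (N - j))"
    unfolding sum_distrib_left
    by (intro sum.cong refl)
      (simp add: one_minus_powr_def binomial_gbinomial mult_ac flip: power_add)
  also have "\<dots> = (\<Sum>j\<le>N. ?f j)"
    by (intro sum.cong) auto
  also have "\<dots> = (\<Sum>j\<le>max K N. ?f j)"
    by (intro sum.mono_neutral_left) auto
  also have "\<dots> = (\<Sum>j\<le>K. ?f j)"
    by (intro sum.mono_neutral_right) auto
  finally show ?thesis .
qed

lemma one_minus_power_expand: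
  "(1 - z) ^ K = (\<Sum>j\<le>K. of_int ((- 1) ^ j * int (K choose j)) * (z :: laurent) ^ j)"
proof -
  have "(1 - z) ^ K = (- z + 1) ^ K" by simp
  also have "\<dots> = (\<Sum>j\<le>K. of_nat (K choose j) * (- z) ^ j * 1 ^ (K - j))"
    by (rule binomial_ring)
  also have "\<dots> = (\<Sum>j\<le>K. of_int ((- 1) ^ j * int (K choose j)) * z ^ j)"
    by (intro sum.cong refl) (simp add: power_minus[of z] mult_ac)
  finally show ?thesis .
qed

text \<open>Moving (1 - z)^K from the series into the Laurent polynomial rearranges an infinite sum.
  Choosing a term \<open>J s\<close> of every (1 - z s)^K splits it into finitely many series, each
  a translate of one with exponent \<open>u\<close>. These pieces have different Laurent
  polynomials, hence the summability assumption for every \<open>L\<close>.\<close>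

lemma has_CT_sum_shift:
  fixes z :: "'s \<Rightarrow> laurent"
  assumes fin: "finite S"
    and summ: "\<And>L. ct_term L S (\<lambda>_. one_minus_powr u) z summable_on (S \<rightarrow>\<^sub>E UNIV)"
    and sum: "has_CT_sum (L * (\<Prod>s\<in>S. (1 - z s) ^ K)) S (\<lambda>_. one_minus_powr u) z v"
  shows "has_CT_sum L S (\<lambda>_. one_minus_powr (of_nat K + u)) z v"
proof -
  define c where "c = fps_nth (one_minus_powr u)"
  define \<beta> where "\<beta> = (\<lambda>j. (- 1) ^ j * int (K choose j))"
  let ?X = "S \<rightarrow>\<^sub>E (UNIV :: nat set)"
  let ?J = "S \<rightarrow>\<^sub>E {..K}"
  define g where "g = (\<lambda>J N. \<Prod>s\<in>S. if J s \<le> N s then of_int (\<beta> (J s)) * c (N s - J s) else 0)"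
  define f where "f = (\<lambda>J N. g J N * CT (L * (\<Prod>s\<in>S. z s ^ N s)))"
  define e where "e = (\<lambda>J M. of_int (\<Prod>s\<in>S. \<beta> (J s)) * ct_term (L * (\<Prod>s\<in>S. z s ^ J s)) S (\<lambda>_. one_minus_powr u) z M)"
  have finJ: "finite ?J" using fin by (intro finite_PiE) auto
  have e: "(e J has_sum infsum (e J) ?X) ?X" for J
    unfolding e_def by (intro has_sum_infsum summable_on_cmult_right summ)
  have fe: "(f J has_sum infsum (e J) ?X) ?X" if J: "J \<in> ?J" for J
  proof -
    \<comment> \<open>Translation by \<open>J\<close> maps the terms of \<open>e J\<close> to those
      of \<open>f J\<close>; the multi-indices not reached have some N s < J s, and there
      \<open>f J\<close> vanishes.\<close>
    define h where "h = (\<lambda>M. restrict (\<lambda>s. M s + J s :: nat) S)"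
    have inj: "inj_on h ?X"
    proof (rule inj_onI)
      fix M N assume *: "M \<in> ?X" "N \<in> ?X" "h M = h N"
      show "M = N"
      proof (rule PiE_ext[OF *(1,2)])
        fix s assume "s \<in> S"
        with fun_cong[OF *(3), of s] show "M s = N s" by (simp add: h_def)
      qed
    qed
    have fh: "f J (h M) = e J M" if M: "M \<in> ?X" for M
    proof -
      have "(\<Prod>s\<in>S. z s ^ (M s + J s)) = (\<Prod>s\<in>S. z s ^ J s) * (\<Prod>s\<in>S. z s ^ M s)"
        by (simp add: power_add prod.distrib mult.commute)
      then show ?thesis
        by (simp add: f_def g_def h_def e_def ct_term_def c_def prod.distrib mult_ac)
    qed
    have im: "h ` ?X = {N \<in> ?X. \<forall>s\<in>S. J s \<le> N s}"
    proof (intro equalityI subsetI)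
      fix N assume N: "N \<in> {N \<in> ?X. \<forall>s\<in>S. J s \<le> N s}"
      have "N = h (restrict (\<lambda>s. N s - J s) S)"
        by (rule PiE_ext[of N S "\<lambda>_. UNIV"]) (use N in \<open>auto simp: h_def\<close>)
      then show "N \<in> h ` ?X" by auto
    qed (auto simp: h_def)
    have "(e J has_sum infsum (e J) ?X) ?X" by (rule e)
    also have "?this \<longleftrightarrow> (f J has_sum infsum (e J) ?X) (h ` ?X)"
      using has_sum_reindex[OF inj, of "f J"] has_sum_cong[of ?X "f J \<circ> h" "e J"] fh by simp
    also have "\<dots> \<longleftrightarrow> (f J has_sum infsum (e J) ?X) ?X"
    proof (rule has_sum_cong_neutral)
      fix N assume "N \<in> ?X - h ` ?X"
      then obtain s where "s \<in> S" "\<not> J s \<le> N s" unfolding im by auto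
      then show "f J N = 0" using fin by (auto simp: f_def g_def)
    qed (auto simp: im)
    finally show ?thesis .
  qed
  have F: "(\<Sum>J\<in>?J. f J N) = ct_term L S (\<lambda>_. one_minus_powr (of_nat K + u)) z N" for N
  proof -
    have "(\<Sum>J\<in>?J. g J N) = (\<Prod>s\<in>S. \<Sum>j\<le>K. if j \<le> N s then of_int (\<beta> j) * c (N s - j) else 0)"
      unfolding g_def
      using prod_sum_PiE[OF fin, of "\<lambda>_. {..K}" "\<lambda>s j. if j \<le> N s then of_int (\<beta> j) * c (N s - j) else 0"]
      by simp
    also have "\<dots> = (\<Prod>s\<in>S. fps_nth (one_minus_powr (of_nat K + u)) (N s))"
      unfolding one_minus_powr_shift \<beta>_def c_def by (rule refl)
    finally show ?thesis
      unfolding f_def ct_term_def by (simp flip: sum_distrib_right)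
  qed
  have E: "(\<Sum>J\<in>?J. e J M) = ct_term (L * (\<Prod>s\<in>S. (1 - z s) ^ K)) S (\<lambda>_. one_minus_powr u) z M" for M
  proof -
    have "(\<Prod>s\<in>S. (1 - z s) ^ K) = (\<Sum>J\<in>?J. of_int (\<Prod>s\<in>S. \<beta> (J s)) * (\<Prod>s\<in>S. z s ^ J s))"
      unfolding one_minus_power_expand
      using prod_sum_PiE[OF fin, of "\<lambda>_. {..K}" "\<lambda>s j. of_int (\<beta> j) * z s ^ j"]
      by (simp add: \<beta>_def prod.distrib)
    then have *: "L * (\<Prod>s\<in>S. (1 - z s) ^ K) * (\<Prod>s\<in>S. z s ^ M s) =
       (\<Sum>J\<in>?J. of_int (\<Prod>s\<in>S. \<beta> (J s)) * (L * (\<Prod>s\<in>S. z s ^ J s) * (\<Prod>s\<in>S. z s ^ M s)))"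
      by (simp add: sum_distrib_left sum_distrib_right mult_ac)
    show ?thesis
      unfolding ct_term_def e_def * CT_sum CT_of_int_mult sum_distrib_left
      by (intro sum.cong refl) (simp only: mult_ac)
  qed
  have "((\<lambda>M. \<Sum>J\<in>?J. e J M) has_sum (\<Sum>J\<in>?J. infsum (e J) ?X)) ?X"
    by (rule has_sum_sum_finite[OF finJ e])
  then have "(\<Sum>J\<in>?J. infsum (e J) ?X) = v"
    using sum has_sum_unique unfolding E has_CT_sum_def by blast
  moreover have "((\<lambda>N. \<Sum>J\<in>?J. f J N) has_sum (\<Sum>J\<in>?J. infsum (e J) ?X)) ?X"
    by (rule has_sum_sum_finite[OF finJ fe])
  ultimately show ?thesis
    unfolding F has_CT_sum_def by simp
qed

section \<open>Bounds on the coefficients of (1 - z)^e that are uniform in e\<close>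

lemma one_minus_powr_nth: "fps_nth (one_minus_powr u) M = pochhammer (- u) M / fact M"
  by (simp add: one_minus_powr_def gbinomial_pochhammer flip: power_add mult.assoc)

text \<open>The coefficient of z^M in (1 - z)^e, kept real so that its sign can be used.\<close>

definition one_minus_coeff :: "real \<Rightarrow> nat \<Rightarrow> real" where
  "one_minus_coeff e M = pochhammer (- e) M / fact M"

lemma one_minus_powr_of_real: "fps_nth (one_minus_powr (of_real e)) M = of_real (one_minus_coeff e M)"
  by (simp add: one_minus_powr_nth one_minus_coeff_def flip: of_real_minus pochhammer_of_real)

lemma one_minus_coeff_Suc: "one_minus_coeff e (Suc M) = - e * (pochhammer (1 - e) M / fact (Suc M))"
  by (simp add: one_minus_coeff_def pochhammer_rec)

text \<open>Partial sums are the coefficients of (1 - z)^e / (1 - z) = (1 - z)^(e-1).\<close>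

lemma sum_one_minus_coeff: "(\<Sum>M\<le>N. one_minus_coeff e M) = pochhammer (1 - e) N / fact N"
proof (induction N)
  case (Suc N)
  then show ?case
    by (simp add: one_minus_coeff_Suc pochhammer_Suc field_simps del: of_nat_Suc) (simp add: algebra_simps)
qed (simp add: one_minus_coeff_def)

lemma pochhammer_one_minus_bounds:
  fixes e :: real
  assumes "0 < e" "e < 1"
  shows "0 \<le> pochhammer (1 - e) N" "pochhammer (1 - e) N \<le> fact N"
proof -
  show nn: "0 \<le> pochhammer (1 - e) N" for N
    using assms by (intro pochhammer_nonneg) auto
  show "pochhammer (1 - e) N \<le> fact N"
  proof (induction N)
    case (Suc N)
    have "pochhammer (1 - e) N * (1 - e + N) \<le> fact N * (1 + real N)"
      using assms Suc nn[of N] by (intro mult_mono) auto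
    then show ?case by (simp add: pochhammer_Suc algebra_simps)
  qed simp
qed

lemma abs_one_minus_coeff_le:
  assumes "0 < e" "e < 1" "1 \<le> M"
  shows "\<bar>one_minus_coeff e M\<bar> \<le> e"
proof -
  obtain N where M: "M = Suc N" using assms by (cases M) auto
  have "pochhammer (1 - e) N / fact (Suc N) \<le> fact N / fact (Suc N)"
    using assms pochhammer_one_minus_bounds by (intro divide_right_mono) auto
  also have "\<dots> \<le> 1" by (simp add: divide_simps)
  finally have "pochhammer (1 - e) N / fact (Suc N) \<le> 1" .
  then have "e * (pochhammer (1 - e) N / fact (Suc N)) \<le> e * 1"
    using assms by (intro mult_left_mono) auto
  moreover have "\<bar>one_minus_coeff e M\<bar> = e * (pochhammer (1 - e) N / fact (Suc N))"
    unfolding M one_minus_coeff_Suc using assms pochhammer_one_minus_bounds(1)[of e N]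
    by (simp add: abs_mult del: fact_Suc)
  ultimately show ?thesis by simp
qed

text \<open>The coefficient at 0 is 1 and the later ones are nonpositive, so the sum of absolute
  values is 2 minus the plain partial sum, which is nonnegative.\<close>

lemma sum_abs_one_minus_coeff_le:
  assumes "0 < e" "e < 1"
  shows "(\<Sum>M\<le>N. \<bar>one_minus_coeff e M\<bar>) \<le> 2"
proof -
  have "one_minus_coeff e M \<le> 0" if "M > 0" for M
    using that pochhammer_one_minus_bounds(1)[of e "M - 1"] assms
    by (cases M) (auto simp: one_minus_coeff_Suc mult_nonneg_nonneg simp del: fact_Suc)
  then have "\<bar>one_minus_coeff e M\<bar> = (if M = 0 then 2 else 0) - one_minus_coeff e M" for M
    by (cases "M = 0") (simp_all add: abs_of_nonpos, simp add: one_minus_coeff_def)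
  then have "(\<Sum>M\<le>N. \<bar>one_minus_coeff e M\<bar>) = (\<Sum>M\<le>N. (if M = 0 then 2 else 0) - one_minus_coeff e M)"
    by simp
  also have "\<dots> = 2 - pochhammer (1 - e) N / fact N"
    by (simp add: sum_subtractf sum_one_minus_coeff)
  also have "\<dots> \<le> 2"
    using pochhammer_one_minus_bounds(1)[OF assms] by simp
  finally show ?thesis .
qed

text \<open>Linear independence of the incidence vectors; for arcs without loops this says that the
  underlying multigraph is a forest.\<close>

definition arc_independent :: "(nat \<times> nat) set \<Rightarrow> bool" where
  "arc_independent T \<longleftrightarrow> (\<forall>d :: nat \<times> nat \<Rightarrow> int.
     (\<forall>v. (\<Sum>s\<in>T. d s * Poly_Mapping.lookup (arcvec s) v) = 0) \<longrightarrow> (\<forall>s\<in>T. d s = 0))"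

definition coeff_norm :: "laurent \<Rightarrow> real" where
  "coeff_norm W = (\<Sum>v\<in>Poly_Mapping.keys W. norm (Poly_Mapping.lookup W v))"

text \<open>Two multi-indices with the same image differ only on \<open>T\<close>, and their
  difference is a linear relation between the arc vectors of \<open>T\<close>.\<close>

lemma inj_on_restrict_arc_exponent:
  assumes fin: "finite A" and T: "T \<subseteq> A" "arc_independent T"
  shows "inj_on (\<lambda>M. (restrict M (A - T), arc_exponent A M)) (A \<rightarrow>\<^sub>E UNIV)"
proof (rule inj_onI)
  fix M M' :: "nat \<times> nat \<Rightarrow> nat"
  assume *: "M \<in> A \<rightarrow>\<^sub>E UNIV" "M' \<in> A \<rightarrow>\<^sub>E UNIV"
    "(restrict M (A - T), arc_exponent A M) = (restrict M' (A - T), arc_exponent A M')"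
  have eq: "M s = M' s" if "s \<in> A - T" for s
  proof -
    have "restrict M (A - T) s = restrict M' (A - T) s" using *(3) by simp
    with that show ?thesis by simp
  qed
  have w: "arc_exponent A M = arc_exponent A M'" using *(3) by simp
  have "(\<Sum>s\<in>T. (int (M s) - int (M' s)) * Poly_Mapping.lookup (arcvec s) v) = 0" for v
  proof -
    have "(\<Sum>s\<in>T. (int (M s) - int (M' s)) * Poly_Mapping.lookup (arcvec s) v) =
        (\<Sum>s\<in>A. (int (M s) - int (M' s)) * Poly_Mapping.lookup (arcvec s) v)"
      using fin T eq by (intro sum.mono_neutral_left) auto
    also have "\<dots> = Poly_Mapping.lookup (arc_exponent A M) v - Poly_Mapping.lookup (arc_exponent A M') v"
      by (simp add: lookup_arc_exponent left_diff_distrib sum_subtractf)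
    finally show ?thesis using w by simp
  qed
  then have "\<forall>s\<in>T. int (M s) - int (M' s) = 0"
    using T(2) unfolding arc_independent_def by (elim allE[of _ "\<lambda>s. int (M s) - int (M' s)"]) blast
  then have "M s = M' s" if "s \<in> A" for s using that eq by (cases "s \<in> T") auto
  then show "M = M'" using * by (intro PiE_ext[of M A "\<lambda>_. UNIV" M']) auto
qed

text \<open>A multi-index in \<open>X\<close> is determined by its values outside \<open>T\<close> and its exponent vector, so every
  element of \<open>T\<close> gains a factor \<open>e\<close> at no cost.\<close>

lemma ct_term_sum_bound:
  assumes fin: "finite A" and T: "T \<subseteq> A" "arc_independent T" and e: "0 < e" "e < 1"
    and X: "X \<subseteq> A \<rightarrow>\<^sub>E UNIV" "finite X" and pos: "\<And>M s. M \<in> X \<Longrightarrow> s \<in> T \<Longrightarrow> 1 \<le> M s"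
  shows "(\<Sum>M\<in>X. norm (ct_term W A (\<lambda>_. one_minus_powr (of_real e)) arcmon M))
    \<le> e ^ card T * (2 ^ card (A - T) * coeff_norm W)"
proof -
  let ?w = "\<lambda>v. norm (Poly_Mapping.lookup W v)"
  define \<phi> where "\<phi> = (\<lambda>M. (restrict M (A - T), - arc_exponent A M))"
  define X0 where "X0 = {M \<in> X. - arc_exponent A M \<in> Poly_Mapping.keys W}"
  \<comment> \<open>Any common bound for the entries of the finite set \<open>X\<close> will do: it
    only makes the box of exponents outside \<open>T\<close> finite, and the final estimate does not
    depend on it.\<close>
  obtain N where N: "\<And>M s. M \<in> X \<Longrightarrow> s \<in> A \<Longrightarrow> M s \<le> N"
  proof
    fix M s assume "M \<in> X" "s \<in> A"
    then show "M s \<le> (\<Sum>M\<in>X. \<Sum>s\<in>A. M s)"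
      by (intro order_trans[OF member_le_sum[of s A M] member_le_sum[of M X "\<lambda>M. \<Sum>s\<in>A. M s"]])
        (use fin X in auto)
  qed
  have inj: "inj_on \<phi> X"
    using inj_on_subset[OF inj_on_restrict_arc_exponent[OF fin T] X(1)]
    by (auto simp: \<phi>_def inj_on_def)
  have "(\<Sum>M\<in>X. norm (ct_term W A (\<lambda>_. one_minus_powr (of_real e)) arcmon M))
      = (\<Sum>M\<in>X0. norm (ct_term W A (\<lambda>_. one_minus_powr (of_real e)) arcmon M))"
    using X by (intro sum.mono_neutral_right) (auto simp: X0_def ct_term_arcmon in_keys_iff)
  also have "\<dots> \<le> (\<Sum>M\<in>X0. e ^ card T * ((\<Prod>s\<in>A - T. \<bar>one_minus_coeff e (M s)\<bar>) * ?w (- arc_exponent A M)))"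
  proof (rule sum_mono)
    fix M assume M: "M \<in> X0"
    have "(\<Prod>s\<in>A. \<bar>one_minus_coeff e (M s)\<bar>) = (\<Prod>s\<in>T. \<bar>one_minus_coeff e (M s)\<bar>) * (\<Prod>s\<in>A - T. \<bar>one_minus_coeff e (M s)\<bar>)"
      using fin T by (metis prod.subset_diff mult.commute)
    also have "\<dots> \<le> (\<Prod>s\<in>T. e) * (\<Prod>s\<in>A - T. \<bar>one_minus_coeff e (M s)\<bar>)"
      using M e pos by (intro mult_right_mono prod_mono) (auto simp: X0_def abs_one_minus_coeff_le prod_nonneg)
    finally have "(\<Prod>s\<in>A. \<bar>one_minus_coeff e (M s)\<bar>) \<le> e ^ card T * (\<Prod>s\<in>A - T. \<bar>one_minus_coeff e (M s)\<bar>)" by simp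
    then show "norm (ct_term W A (\<lambda>_. one_minus_powr (of_real e)) arcmon M)
        \<le> e ^ card T * ((\<Prod>s\<in>A - T. \<bar>one_minus_coeff e (M s)\<bar>) * ?w (- arc_exponent A M))"
      by (auto simp: ct_term_arcmon norm_mult one_minus_powr_of_real simp flip: prod_norm mult.assoc
          intro!: mult_right_mono)
  qed
  also have "\<dots> = e ^ card T * (\<Sum>M\<in>X0. (\<lambda>(R, v). (\<Prod>s\<in>A - T. \<bar>one_minus_coeff e (R s)\<bar>) * ?w v) (\<phi> M))"
    by (simp add: sum_distrib_left \<phi>_def)
  also have "(\<Sum>M\<in>X0. (\<lambda>(R, v). (\<Prod>s\<in>A - T. \<bar>one_minus_coeff e (R s)\<bar>) * ?w v) (\<phi> M)) =
      (\<Sum>(R, v)\<in>\<phi> ` X0. (\<Prod>s\<in>A - T. \<bar>one_minus_coeff e (R s)\<bar>) * ?w v)"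
    using inj by (subst sum.reindex) (auto simp: X0_def o_def inj_on_def)
  \<comment> \<open>As the map is injective, the sum may be enlarged to the whole box times the
    monomials of \<open>W\<close>, where it factors into one sum per arc outside \<open>T\<close>
    and \<open>coeff_norm W\<close>.\<close>
  also have "\<dots> \<le> (\<Sum>(R, v)\<in>(A - T \<rightarrow>\<^sub>E {..N}) \<times> Poly_Mapping.keys W. (\<Prod>s\<in>A - T. \<bar>one_minus_coeff e (R s)\<bar>) * ?w v)"
  proof (rule sum_mono2)
    show "\<phi> ` X0 \<subseteq> (A - T \<rightarrow>\<^sub>E {..N}) \<times> Poly_Mapping.keys W"
    proof (rule image_subsetI)
      fix M assume "M \<in> X0"
      then show "\<phi> M \<in> (A - T \<rightarrow>\<^sub>E {..N}) \<times> Poly_Mapping.keys W"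
        using N[of M] by (simp add: \<phi>_def X0_def restrict_PiE_iff)
    qed
  qed (use fin in \<open>auto simp: prod_nonneg intro!: finite_PiE\<close>)
  also have "\<dots> = (\<Sum>R\<in>A - T \<rightarrow>\<^sub>E {..N}. \<Prod>s\<in>A - T. \<bar>one_minus_coeff e (R s)\<bar>) * coeff_norm W"
    by (simp add: coeff_norm_def sum_product sum.cartesian_product)
  also have "(\<Sum>R\<in>A - T \<rightarrow>\<^sub>E {..N}. \<Prod>s\<in>A - T. \<bar>one_minus_coeff e (R s)\<bar>) = (\<Prod>s\<in>A - T. \<Sum>M\<le>N. \<bar>one_minus_coeff e M\<bar>)"
    using fin by (subst prod_sum_PiE) auto
  also have "(\<Prod>s\<in>A - T. \<Sum>M\<le>N. \<bar>one_minus_coeff e M\<bar>) * coeff_norm W \<le> (\<Prod>s\<in>A - T. 2) * coeff_norm W"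
    using e by (intro mult_right_mono prod_mono)
      (auto simp: sum_abs_one_minus_coeff_le coeff_norm_def intro!: sum_nonneg)
  finally show ?thesis using e by simp
qed

text \<open>The case of an empty forest: all finite partial sums are at most 2^|A| times
  \<open>coeff_norm W\<close>.\<close>

lemma ct_term_abs_summable:
  assumes "finite A" "0 < e" "e < 1"
  shows "(\<lambda>M. norm (ct_term W A (\<lambda>_. one_minus_powr (of_real e)) arcmon M)) summable_on (A \<rightarrow>\<^sub>E UNIV)"
proof (rule nonneg_bdd_above_summable_on)
  show "bdd_above (sum (\<lambda>M. norm (ct_term W A (\<lambda>_. one_minus_powr (of_real e)) arcmon M)) ` 
    {F. F \<subseteq> A \<rightarrow>\<^sub>E UNIV \<and> finite F})"
    by (rule bdd_aboveI[of _ "e ^ card {} * (2 ^ card (A - {}) * coeff_norm W)"])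
      (use assms in \<open>auto simp: arc_independent_def intro!: ct_term_sum_bound[where T = "{}", simplified]\<close>)
qed auto

lemma ct_term_infsum_bound:
  assumes "finite A" "T \<subseteq> A" "arc_independent T" "0 < e" "e < 1" "X \<subseteq> A \<rightarrow>\<^sub>E UNIV"
    and "\<And>M s. M \<in> X \<Longrightarrow> s \<in> T \<Longrightarrow> 1 \<le> M s"
  shows "norm (infsum (ct_term W A (\<lambda>_. one_minus_powr (of_real e)) arcmon) X)
    \<le> e ^ card T * (2 ^ card (A - T) * coeff_norm W)"
proof -
  have s: "(\<lambda>M. norm (ct_term W A (\<lambda>_. one_minus_powr (of_real e)) arcmon M)) summable_on X"
    using ct_term_abs_summable[OF assms(1,4,5)] assms(6) summable_on_subset_banach by blast
  show ?thesis
    by (rule order_trans[OF norm_infsum_bound[OF s] infsum_le_finite_sums[OF s ct_term_sum_bound]])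
      (use assms in auto)
qed

section \<open>Contributions of the supports\<close>

lemma ct_term_reindex:
  fixes h :: "'s \<Rightarrow> 't"
  assumes h: "bij_betw h S S'"
  shows "(ct_term W S (\<lambda>s. F (h s)) (\<lambda>s. z (h s)) has_sum v) (S \<rightarrow>\<^sub>E UNIV) \<longleftrightarrow>
    (ct_term W S' F z has_sum v) (S' \<rightarrow>\<^sub>E UNIV)"
proof -
  let ?g = "inv_into S h"
  have g: "?g t \<in> S" "h (?g t) = t" if "t \<in> S'" for t
    using that h by (auto simp: bij_betw_def inv_into_into f_inv_into_f)
  have hS: "h s \<in> S'" "?g (h s) = s" if "s \<in> S" for s
    using that h by (auto simp: bij_betw_def)
  show ?thesis
  proof (rule has_sum_reindex_bij_witness
      [where j = "\<lambda>N. restrict (\<lambda>t. N (?g t)) S'" and i = "\<lambda>M. restrict (\<lambda>s. M (h s)) S"])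
    fix N :: "'s \<Rightarrow> nat" assume N: "N \<in> S \<rightarrow>\<^sub>E UNIV"
    show "restrict (\<lambda>s. restrict (\<lambda>t. N (?g t)) S' (h s)) S = N"
      by (rule PiE_ext[of _ S "\<lambda>_. UNIV"]) (use N hS in auto)
    have *: "(\<Prod>s\<in>S. u (h s) (N s)) = (\<Prod>t\<in>S'. u t (N (?g t)))" for u :: "'t \<Rightarrow> nat \<Rightarrow> 'c::comm_monoid_mult"
      using prod.reindex_bij_betw[OF h, of "\<lambda>t. u t (N (?g t))"] hS by simp
    show "ct_term W S' F z (restrict (\<lambda>t. N (?g t)) S') = ct_term W S (\<lambda>s. F (h s)) (\<lambda>s. z (h s)) N"
      unfolding ct_term_def using *[of "\<lambda>t. fps_nth (F t)"] *[of "\<lambda>t N. z t ^ N"] by simp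
  next
    fix M :: "'t \<Rightarrow> nat" assume M: "M \<in> S' \<rightarrow>\<^sub>E UNIV"
    show "restrict (\<lambda>t. restrict (\<lambda>s. M (h s)) S (?g t)) S' = M"
      by (rule PiE_ext[of _ S' "\<lambda>_. UNIV"]) (use M g in auto)
  qed auto
qed

lemma infsum_eq_if_has_sum_iff:
  fixes f :: "'a \<Rightarrow> 'c::{comm_monoid_add, t2_space}"
  assumes "\<And>v. (f has_sum v) A \<longleftrightarrow> (g has_sum v) B"
  shows "infsum f A = infsum g B"
proof (cases "f summable_on A")
  case True
  then show ?thesis using assms by (metis has_sum_infsum infsumI)
next
  case False
  then have "\<not> g summable_on B" using assms by (simp add: summable_on_def)
  then show ?thesis using False by (simp add: infsum_not_exists)
qed

section \<open>Forests and matchings in terms of arc vectors\<close>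

abbreviation touch :: "nat \<times> nat \<Rightarrow> nat set" where
  "touch s \<equiv> {fst s, snd s}"

definition vertices :: "(nat \<times> nat) set \<Rightarrow> nat set" where
  "vertices E = (\<Union>s\<in>E. touch s)"

definition matching :: "(nat \<times> nat) set \<Rightarrow> bool" where
  "matching E \<longleftrightarrow> (\<forall>s\<in>E. \<forall>t\<in>E. s \<noteq> t \<longrightarrow> touch s \<inter> touch t = {})"

text \<open>At a vertex that lies on \<open>t\<close> only, the relation reduces to plus or minus d
  t = 0; this is the leaf argument for forests.\<close>

lemma arc_independent_private_vertex:
  assumes "finite T" "t \<in> T" "fst t \<noteq> snd t" "v \<in> touch t"
    and "\<And>s. s \<in> T \<Longrightarrow> s \<noteq> t \<Longrightarrow> v \<notin> touch s"
    and "(\<Sum>s\<in>T. d s * Poly_Mapping.lookup (arcvec s) v) = 0"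
  shows "d t = (0::int)"
proof -
  have "(\<Sum>s\<in>T. d s * Poly_Mapping.lookup (arcvec s) v) = (\<Sum>s\<in>{t}. d s * Poly_Mapping.lookup (arcvec s) v)"
    using assms(1,2,5) by (intro sum.mono_neutral_right) (auto simp: lookup_arcvec)
  then show ?thesis
    using assms(3,4,6) by (auto simp: lookup_arcvec)
qed

lemma arc_independent_insert:
  assumes "finite T" "arc_independent T" "e \<notin> T" "fst e \<noteq> snd e" "v \<in> touch e" "v \<notin> vertices T"
  shows "arc_independent (insert e T)"
  unfolding arc_independent_def
proof (intro allI impI)
  fix d :: "nat \<times> nat \<Rightarrow> int"
  assume d: "\<forall>v. (\<Sum>s\<in>insert e T. d s * Poly_Mapping.lookup (arcvec s) v) = 0"
  have "d e = 0"
    by (rule arc_independent_private_vertex[of "insert e T" e v d]) (use assms d in \<open>auto simp: vertices_def\<close>)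
  then show "\<forall>s\<in>insert e T. d s = 0"
    using d assms(1,2,3) by (auto simp: arc_independent_def)
qed

lemma arc_independent_matching:
  assumes "finite T" "matching T" "\<And>s. s \<in> T \<Longrightarrow> fst s \<noteq> snd s"
  shows "arc_independent T"
  unfolding arc_independent_def
proof (intro allI impI ballI)
  fix d :: "nat \<times> nat \<Rightarrow> int" and t
  assume d: "\<forall>v. (\<Sum>s\<in>T. d s * Poly_Mapping.lookup (arcvec s) v) = 0" and t: "t \<in> T"
  show "d t = 0"
    by (rule arc_independent_private_vertex[of T t "fst t" d]) (use assms d t in \<open>auto simp: matching_def\<close>)
qed

text \<open>Since \<open>e\<close> is not parallel to an arc of the matching, every such arc has an
  end off \<open>e\<close>, hence a private vertex. Its coefficient vanishes, and then so does that
  of \<open>e\<close>.\<close>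

lemma arc_independent_insert_matching:
  assumes "finite T" "matching T" "\<And>s. s \<in> insert e T \<Longrightarrow> fst s \<noteq> snd s"
    and "e \<notin> T" "prod.swap e \<notin> T"
  shows "arc_independent (insert e T)"
  unfolding arc_independent_def
proof (intro allI impI)
  fix d :: "nat \<times> nat \<Rightarrow> int"
  assume d: "\<forall>v. (\<Sum>s\<in>insert e T. d s * Poly_Mapping.lookup (arcvec s) v) = 0"
  have T0: "d t = 0" if t: "t \<in> T" for t
  proof -
    have "t \<noteq> e" "t \<noteq> prod.swap e" using t assms(4,5) by auto
    then obtain v where v: "v \<in> touch t" "v \<notin> touch e"
      using assms(3)[of t] t by (cases t; cases e) auto
    show ?thesis
      by (rule arc_independent_private_vertex[of "insert e T" t v d])
        (use assms d t v in \<open>auto simp: matching_def\<close>)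
  qed
  have "d e * Poly_Mapping.lookup (arcvec e) (fst e) = 0"
    using d assms(1,4) T0 by (auto dest: spec[of _ "fst e"])
  then show "\<forall>s\<in>insert e T. d s = 0"
    using T0 assms(3)[of e] by (auto simp: lookup_arcvec)
qed

lemma finite_vertices: "finite E \<Longrightarrow> finite (vertices E)"
  by (simp add: vertices_def)

lemma card_vertices_le: "finite E \<Longrightarrow> card (vertices E) \<le> 2 * card E"
proof (induction E rule: finite_induct)
  case (insert s E)
  have "vertices (insert s E) = touch s \<union> vertices E" by (auto simp: vertices_def)
  moreover have "card (touch s) \<le> 2" by (simp add: card_insert_if)
  ultimately show ?case
    using insert card_Un_le[of "touch s" "vertices E"] by simp
qed (simp add: vertices_def)

text \<open>Equality in \<open>card_vertices_le\<close> leaves no room for a shared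
  endpoint.\<close>

lemma matching_if_card_vertices:
  assumes "finite T" "2 * card T \<le> card (vertices T)"
  shows "matching T"
proof -
  have "touch t \<inter> vertices (T - {t}) = {}" if t: "t \<in> T" for t
  proof -
    have "vertices T = touch t \<union> vertices (T - {t})" using t by (auto simp: vertices_def)
    then have "card (vertices T) = card (touch t \<union> vertices (T - {t}))" by (rule arg_cong)
    moreover have "card (touch t) \<le> 2" by (simp add: card_insert_if)
    moreover have "card (vertices (T - {t})) \<le> 2 * card (T - {t})" using assms by (intro card_vertices_le) auto
    moreover have "card T = Suc (card (T - {t}))" using assms t by (metis card_Suc_Diff1)
    moreover have "card (touch t) + card (vertices (T - {t})) =
        card (touch t \<union> vertices (T - {t})) + card (touch t \<inter> vertices (T - {t}))"
      using assms by (intro card_Un_Int) (auto simp: finite_vertices)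
    ultimately have "card (touch t \<inter> vertices (T - {t})) = 0" using assms(2) by linarith
    then show ?thesis by simp
  qed
  moreover have "touch s \<subseteq> vertices (T - {t})" if "s \<in> T" "s \<noteq> t" for s t
    using that by (auto simp: vertices_def)
  ultimately show ?thesis unfolding matching_def by blast
qed

text \<open>A largest independent \<open>T\<close> covers all vertices of \<open>E\<close>, so it
  has at least \<open>m\<close> arcs. If it had exactly \<open>m\<close>, it would be a matching,
  hence different from \<open>E\<close>, and any further arc of \<open>E\<close> could be added
  without losing independence.\<close>

lemma exists_large_arc_independent:
  assumes fin: "finite E" and loop: "\<And>s. s \<in> E \<Longrightarrow> fst s \<noteq> snd s"
    and opp: "\<And>s. s \<in> E \<Longrightarrow> prod.swap s \<notin> E"
    and cov: "2 * m \<le> card (vertices E)" and no: "\<not> (matching E \<and> card E = m)"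
  shows "\<exists>T\<subseteq>E. arc_independent T \<and> m < card T"
proof (rule ccontr)
  assume neg: "\<not> ?thesis"
  let ?I = "{T. T \<subseteq> E \<and> arc_independent T}"
  have "finite (card ` ?I)" "card ` ?I \<noteq> {}"
    using fin by (auto simp: arc_independent_def intro!: exI[of _ "{}"])
  then obtain T where T: "T \<subseteq> E" "arc_independent T" and max: "\<And>T'. T' \<subseteq> E \<Longrightarrow> arc_independent T' \<Longrightarrow> card T' \<le> card T"
    using Max_in[of "card ` ?I"] Max_ge[of "card ` ?I"] by (smt (verit) imageE image_eqI mem_Collect_eq)
  have finT: "finite T" using T fin finite_subset by blast
  have ins: "\<not> arc_independent (insert e T)" if "e \<in> E - T" for e
    using max[of "insert e T"] that T finT by auto
  have "vertices E \<subseteq> vertices T"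
  proof
    fix v assume "v \<in> vertices E"
    then obtain e where e: "e \<in> E" "v \<in> touch e" by (auto simp: vertices_def)
    show "v \<in> vertices T"
    proof (rule ccontr)
      assume v: "v \<notin> vertices T"
      then have "e \<notin> T" using e by (auto simp: vertices_def)
      then show False using ins[of e] arc_independent_insert[OF finT T(2) _ loop[OF e(1)] e(2) v] e by auto
    qed
  qed
  then have "2 * m \<le> card (vertices T)"
    using cov card_mono[OF finite_vertices[OF finT], of "vertices E"] by linarith
  moreover have "card (vertices T) \<le> 2 * card T" by (rule card_vertices_le[OF finT])
  moreover have "card T \<le> m" using neg T by force
  ultimately have "card T = m" "matching T"
    using matching_if_card_vertices[OF finT] by auto
  moreover have "E \<noteq> T" using no calculation by auto
  then obtain e where e: "e \<in> E - T" using T by auto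
  ultimately have "arc_independent (insert e T)"
    using T finT loop opp[of "prod.swap e"] by (intro arc_independent_insert_matching) auto
  then show False using ins e by blast
qed

text \<open>The limit and the cancellation between matchings depend on \<open>W\<close> only through
  this behaviour under permutations.\<close>

locale antisymmetric =
  fixes n :: nat and W :: laurent
  assumes permute_vars_W: "\<pi> permutes {1..n} \<Longrightarrow> permute_vars \<pi> W = of_int (inversion_sign n \<pi>) * W"
begin

lemma CT_perm:
  assumes "\<pi> permutes {1..n}"
  shows "CT (W * permute_vars \<pi> f) = of_int (inversion_sign n \<pi>) * CT (W * f)"
proof -
  have bij: "bij \<pi>" using assms by (rule permutes_bij)
  have "W = of_int (inversion_sign n \<pi> * inversion_sign n \<pi>) * W" by (simp add: inversion_sign_square)
  also have "\<dots> = of_int (inversion_sign n \<pi>) * permute_vars \<pi> W" by (simp only: permute_vars_W[OF assms] of_int_mult mult.assoc)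
  finally have "W * permute_vars \<pi> f = of_int (inversion_sign n \<pi>) * permute_vars \<pi> (W * f)"
    using bij by (simp add: permute_vars_mult mult.assoc)
  then show ?thesis using bij by (simp only: CT_of_int_mult CT_permute_vars)
qed

text \<open>The constant term with a logarithm on every arc of \<open>A\<close>. As an
  \<open>infsum\<close> it is defined for every \<open>A\<close>, so its symmetries can be stated
  without convergence assumptions.\<close>

definition logCT :: "(nat \<times> nat) set \<Rightarrow> complex" where
  "logCT A = infsum (ct_term W A (\<lambda>_. log_one_minus) arcmon) (A \<rightarrow>\<^sub>E UNIV)"

lemma logCT_perm:
  assumes "\<pi> permutes {1..n}"
  shows "logCT (map_prod \<pi> \<pi> ` A) = of_int (inversion_sign n \<pi>) * logCT A"
proof -
  let ?h = "map_prod \<pi> \<pi>"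
  have bij: "bij \<pi>" using assms by (rule permutes_bij)
  have h: "bij_betw ?h A (?h ` A)"
    by (intro inj_on_imp_bij_betw inj_on_subset[OF prod.inj_map]) (simp_all add: bij bij_is_inj)
  have "logCT (?h ` A) = infsum (ct_term W A (\<lambda>_. log_one_minus) (\<lambda>s. arcmon (?h s))) (A \<rightarrow>\<^sub>E UNIV)"
    unfolding logCT_def
    by (rule infsum_eq_if_has_sum_iff) (simp add: ct_term_reindex[OF h, of W "\<lambda>_. log_one_minus" arcmon])
  also have "ct_term W A (\<lambda>_. log_one_minus) (\<lambda>s. arcmon (?h s)) =
      (\<lambda>M. of_int (inversion_sign n \<pi>) * ct_term W A (\<lambda>_. log_one_minus) arcmon M)"
  proof
    fix M
    have "(\<Prod>s\<in>A. arcmon (?h s) ^ M s) = permute_vars \<pi> (\<Prod>s\<in>A. arcmon s ^ M s)"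
      using bij by (simp add: permute_vars_prod permute_vars_power permute_vars_arcmon)
    then show "ct_term W A (\<lambda>_. log_one_minus) (\<lambda>s. arcmon (?h s)) M =
        of_int (inversion_sign n \<pi>) * ct_term W A (\<lambda>_. log_one_minus) arcmon M"
      by (simp add: ct_term_def CT_perm[OF assms])
  qed
  also have "infsum \<dots> (A \<rightarrow>\<^sub>E UNIV) = of_int (inversion_sign n \<pi>) * logCT A"
    by (simp add: logCT_def infsum_cmult_right')
  finally show ?thesis .
qed

lemma inversion_sign_transpose_neq:
  assumes "p \<in> {1..n}" "q \<in> {1..n}" "p \<noteq> q"
  shows "inversion_sign n (Transposition.transpose p q) = - 1"
  using assms inversion_sign_transpose[of p n q] inversion_sign_transpose[of q n p]
  by (metis linorder_neqE_nat transpose_commute)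

text \<open>Exchanging the two ends of \<open>s\<close> reverses \<open>s\<close>, fixes all arcs of
  \<open>A\<close>, and is an odd permutation.\<close>

lemma logCT_reverse:
  assumes "fst s \<in> {1..n}" "snd s \<in> {1..n}" "fst s \<noteq> snd s" "touch s \<inter> vertices A = {}"
  shows "logCT (insert (prod.swap s) A) = - logCT (insert s A)"
proof -
  let ?\<pi> = "Transposition.transpose (fst s) (snd s)"
  have "map_prod ?\<pi> ?\<pi> ` A = id ` A"
  proof (rule image_cong)
    fix t assume "t \<in> A"
    then have "touch s \<inter> touch t = {}" using assms(4) by (auto simp: vertices_def)
    then show "map_prod ?\<pi> ?\<pi> t = id t"
      by (cases t) (auto simp: transpose_apply_other)
  qed simp
  then have "map_prod ?\<pi> ?\<pi> ` insert s A = insert (prod.swap s) A"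
    by (cases s) simp
  then show ?thesis
    using logCT_perm[OF permutes_swap_id[OF assms(1,2)], of "insert s A"] inversion_sign_transpose_neq[OF assms(1-3)]
    by simp
qed

text \<open>Exchanging two variables outside \<open>E\<close> fixes the monomials and changes the sign of \<open>W\<close>.\<close>

lemma ct_term_eq_0:
  assumes "p \<in> {1..n} - vertices E" "q \<in> {1..n} - vertices E" "p \<noteq> q"
    and M: "\<And>s. s \<in> A \<Longrightarrow> M s \<noteq> 0 \<Longrightarrow> s \<in> E"
  shows "ct_term W A F arcmon M = 0"
proof -
  let ?\<pi> = "Transposition.transpose p q"
  let ?f = "\<Prod>s\<in>A. arcmon s ^ M s"
  have perm: "?\<pi> permutes {1..n}" using assms by (intro permutes_swap_id) auto
  have "permute_vars ?\<pi> ?f = (\<Prod>s\<in>A. arcmon (map_prod ?\<pi> ?\<pi> s) ^ M s)"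
    using permutes_bij[OF perm] by (simp add: permute_vars_prod permute_vars_power permute_vars_arcmon)
  also have "\<dots> = ?f"
  proof (intro prod.cong refl)
    fix s assume s: "s \<in> A"
    show "arcmon (map_prod ?\<pi> ?\<pi> s) ^ M s = arcmon s ^ M s"
    proof (cases "M s = 0")
      case False
      then have "s \<in> E" using M s by blast
      then have "touch s \<subseteq> vertices E" by (auto simp: vertices_def)
      then have "p \<notin> touch s" "q \<notin> touch s" using assms by blast+
      then have "map_prod ?\<pi> ?\<pi> s = s" by (cases s) (auto simp: transpose_apply_other)
      then show ?thesis by simp
    qed simp
  qed
  finally have "CT (W * ?f) = - CT (W * ?f)"
    using CT_perm[OF perm, of ?f] inversion_sign_transpose_neq[of p q] assms by simp
  then show ?thesis by (simp add: ct_term_def)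
qed

end

definition support_class :: "'a set \<Rightarrow> 'a set \<Rightarrow> ('a \<Rightarrow> nat) set" where
  "support_class A E = {M \<in> A \<rightarrow>\<^sub>E UNIV. \<forall>s\<in>A. M s \<noteq> 0 \<longleftrightarrow> s \<in> E}"

lemma infsum_support_class:
  assumes "finite A" "E \<subseteq> A"
  shows "infsum (ct_term W A (\<lambda>_. one_minus_powr u) z) (support_class A E) =
    infsum (ct_term W E (\<lambda>_. one_minus_powr u) z) (support_class E E)"
proof (rule infsum_reindex_bij_witness
    [where j = "\<lambda>M. restrict M E" and i = "\<lambda>N s. if s \<in> E then N s else if s \<in> A then 0 else undefined"])
  fix M assume M: "M \<in> support_class A E"
  show "(\<lambda>s. if s \<in> E then restrict M E s else if s \<in> A then 0 else undefined) = M"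
    by (rule PiE_ext[of _ A "\<lambda>_. UNIV"]) (use M assms in \<open>auto simp: support_class_def\<close>)
  show "restrict M E \<in> support_class E E"
    using M assms by (auto simp: support_class_def)
  have z: "M s = 0" if "s \<in> A - E" for s using M that by (auto simp: support_class_def)
  have 1: "(\<Prod>s\<in>A. z s ^ M s) = (\<Prod>s\<in>E. z s ^ M s)"
    using assms z by (intro prod.mono_neutral_right) auto
  \<comment> \<open>Arcs outside \<open>E\<close> have exponent 0, and the constant coefficient of
    (1 - z)^u is 1.\<close>
  have 2: "(\<Prod>s\<in>A. fps_nth (one_minus_powr u) (M s)) = (\<Prod>s\<in>E. fps_nth (one_minus_powr u) (M s))"
    using assms z by (intro prod.mono_neutral_right) (auto simp: one_minus_powr_def)
  show "ct_term W E (\<lambda>_. one_minus_powr u) z (restrict M E) = ct_term W A (\<lambda>_. one_minus_powr u) z M"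
    by (simp add: ct_term_def 1 2)
next
  fix N assume N: "N \<in> support_class E E"
  show "restrict (\<lambda>s. if s \<in> E then N s else if s \<in> A then 0 else undefined) E = N"
    by (rule PiE_ext[of _ E "\<lambda>_. UNIV"]) (use N in \<open>auto simp: support_class_def\<close>)
  show "(\<lambda>s. if s \<in> E then N s else if s \<in> A then 0 else undefined) \<in> support_class A E"
    using N assms by (auto simp: support_class_def PiE_iff extensional_def)
qed

text \<open>Coefficientwise, log(1 - z) is the derivative of (1 - z)^e at e = 0. At M = 0 the
  quotient would be 1/e.\<close>

lemma one_minus_coeff_divide_limit:
  "((\<lambda>e. of_real (one_minus_coeff e M) / of_real e) \<longlongrightarrow> fps_nth log_one_minus M) (at_right 0)" if "M \<noteq> 0"
proof -
  obtain N where M: "M = Suc N" using \<open>M \<noteq> 0\<close> not0_implies_Suc by blast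
  have "isCont (\<lambda>e::real. pochhammer (1 - e) N) 0"
    unfolding pochhammer_prod by (intro continuous_intros)
  then have "((\<lambda>e::real. pochhammer (1 - e) N) \<longlongrightarrow> fact N) (at 0)"
    by (simp add: isCont_def pochhammer_fact)
  then have "((\<lambda>e::real. pochhammer (1 - e) N) \<longlongrightarrow> fact N) (at_right 0)"
    by (rule tendsto_mono[OF at_le[OF subset_UNIV]])
  then have "((\<lambda>e. of_real (- (pochhammer (1 - e) N / fact (Suc N))) :: complex) \<longlongrightarrow> of_real (- (fact N / fact (Suc N)))) (at_right 0)"
    by (intro tendsto_intros) auto
  also have "of_real (- (fact N / fact (Suc N))) = fps_nth log_one_minus M"
    by (simp add: M log_one_minus_def divide_simps)
  finally have "((\<lambda>e. of_real (- (pochhammer (1 - e) N / fact (Suc N)))) \<longlongrightarrow> fps_nth log_one_minus M) (at_right 0)" .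
  moreover have "\<forall>\<^sub>F e in at_right 0. of_real (- (pochhammer (1 - e) N / fact (Suc N))) = (of_real (one_minus_coeff e M) / of_real e :: complex)"
    unfolding M one_minus_coeff_Suc by (auto simp: eventually_at_filter simp del: fact_Suc)
  ultimately show ?thesis by (rule Lim_transform_eventually)
qed

text \<open>On an independent arc set each of the finitely many monomials of \<open>W\<close> is met
  by at most one multi-index. Sums over such sets are therefore finite.\<close>

lemma finite_arc_exponent_support:
  assumes "finite A" "arc_independent A"
  shows "finite {M \<in> A \<rightarrow>\<^sub>E UNIV. Poly_Mapping.lookup W (- arc_exponent A M) \<noteq> 0}" (is "finite ?F")
proof (rule finite_imageD)
  show "finite ((\<lambda>M. - arc_exponent A M) ` ?F)"
    by (rule finite_subset[of _ "Poly_Mapping.keys W"]) (auto simp: in_keys_iff)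
  show "inj_on (\<lambda>M. - arc_exponent A M) ?F"
    using inj_on_restrict_arc_exponent[OF assms(1) subset_refl assms(2)]
    by (simp add: inj_on_def restrict_def)
qed

lemma has_sum_support_class:
  assumes "finite E" "arc_independent E"
  shows "(ct_term W E F arcmon has_sum
    (\<Sum>M | M \<in> support_class E E \<and> Poly_Mapping.lookup W (- arc_exponent E M) \<noteq> 0. ct_term W E F arcmon M)) (support_class E E)"
proof (rule has_sum_finite_neutralI)
  show "finite {M \<in> support_class E E. Poly_Mapping.lookup W (- arc_exponent E M) \<noteq> 0}"
    by (rule finite_subset[OF _ finite_arc_exponent_support[OF assms, of W]]) (auto simp: support_class_def)
qed (auto simp: ct_term_arcmon)

text \<open>The logarithm has no constant coefficient, so only multi-indices that are nonzero on
  every arc contribute.\<close>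

lemma has_sum_log:
  assumes "finite E" "arc_independent E"
  shows "(ct_term W E (\<lambda>_. log_one_minus) arcmon has_sum
    (\<Sum>M | M \<in> support_class E E \<and> Poly_Mapping.lookup W (- arc_exponent E M) \<noteq> 0. ct_term W E (\<lambda>_. log_one_minus) arcmon M)) (E \<rightarrow>\<^sub>E UNIV)"
  by (rule iffD1[OF has_sum_cong_neutral has_sum_support_class[OF assms, of W "\<lambda>_. log_one_minus"]])
    (use assms in \<open>auto simp: support_class_def ct_term_arcmon log_one_minus_def\<close>)

lemma norm_of_real_le_tendsto_0:
  fixes f :: "real \<Rightarrow> complex"
  assumes "\<And>e. 0 < e \<Longrightarrow> e < 1 \<Longrightarrow> norm (f e) \<le> e * C"
  shows "(f \<longlongrightarrow> 0) (at_right 0)"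
proof (rule Lim_null_comparison)
  show "\<forall>\<^sub>F e in at_right 0. norm (f e) \<le> e * C"
    using assms unfolding eventually_at_right_field by (auto intro!: exI[of _ 1])
  show "((\<lambda>e. e * C) \<longlongrightarrow> 0) (at_right 0)"
    by (auto intro!: tendsto_eq_intros)
qed

context antisymmetric
begin

text \<open>The sum runs over a finite set that does not depend on \<open>e\<close>; distributing
  one factor 1/e to each arc, the limit is taken term by term.\<close>

lemma matching_limit:
  assumes fin: "finite A" and E: "E \<subseteq> A" "arc_independent E"
  shows "((\<lambda>e. infsum (ct_term W A (\<lambda>_. one_minus_powr (of_real e)) arcmon) (support_class A E) / of_real e ^ card E)
    \<longlongrightarrow> logCT E) (at_right 0)"
proof -
  have finE: "finite E" using E fin finite_subset by blast
  let ?F = "{M. M \<in> support_class E E \<and> Poly_Mapping.lookup W (- arc_exponent E M) \<noteq> 0}"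
  let ?w = "\<lambda>M. Poly_Mapping.lookup W (- arc_exponent E M)"
  have "logCT E = (\<Sum>M\<in>?F. ct_term W E (\<lambda>_. log_one_minus) arcmon M)"
    unfolding logCT_def by (rule infsumI[OF has_sum_log[OF finE E(2)]])
  then have logCT: "logCT E = (\<Sum>M\<in>?F. (\<Prod>s\<in>E. fps_nth log_one_minus (M s)) * ?w M)"
    by (simp add: ct_term_arcmon)
  have L: "infsum (ct_term W A (\<lambda>_. one_minus_powr (of_real e)) arcmon) (support_class A E) / of_real e ^ card E =
    (\<Sum>M\<in>?F. (\<Prod>s\<in>E. of_real (one_minus_coeff e (M s)) / of_real e) * ?w M)" for e
  proof -
    have "infsum (ct_term W A (\<lambda>_. one_minus_powr (of_real e)) arcmon) (support_class A E) =
       (\<Sum>M\<in>?F. ct_term W E (\<lambda>_. one_minus_powr (of_real e)) arcmon M)"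
      unfolding infsum_support_class[OF fin E(1)] by (rule infsumI[OF has_sum_support_class[OF finE E(2)]])
    then show ?thesis
      by (simp add: ct_term_arcmon one_minus_powr_of_real sum_divide_distrib prod_dividef)
  qed
  show ?thesis
    unfolding logCT L
  proof (intro tendsto_sum tendsto_mult tendsto_prod tendsto_const)
    fix M s assume "M \<in> ?F" "s \<in> E"
    then have "M s \<noteq> 0" by (auto simp: support_class_def)
    then show "((\<lambda>e. of_real (one_minus_coeff e (M s)) / of_real e) \<longlongrightarrow> fps_nth log_one_minus (M s)) (at_right 0)"
      by (rule one_minus_coeff_divide_limit)
  qed
qed

lemma other_limit:
  assumes fin: "finite A" and n: "n = 2 * m + 1" and A: "A \<subseteq> {1..n} \<times> {1..n}"
    and loop: "\<And>s. s \<in> A \<Longrightarrow> fst s \<noteq> snd s" and opp: "\<And>s. s \<in> A \<Longrightarrow> prod.swap s \<notin> A"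
    and E: "E \<subseteq> A" "\<not> (matching E \<and> card E = m)"
  shows "((\<lambda>e. infsum (ct_term W A (\<lambda>_. one_minus_powr (of_real e)) arcmon) (support_class A E) / of_real e ^ m)
    \<longlongrightarrow> 0) (at_right 0)"
proof (cases "2 * m \<le> card (vertices E)")
  case True
  have finE: "finite E" using E fin finite_subset by blast
  obtain S where S: "S \<subseteq> E" "arc_independent S" "m < card S"
    using exists_large_arc_independent[OF finE _ _ True E(2)] loop opp E(1) by blast
  define C where "C = 2 ^ card (A - S) * coeff_norm W"
  have C: "0 \<le> C" by (simp add: C_def coeff_norm_def sum_nonneg)
  show ?thesis
  proof (rule norm_of_real_le_tendsto_0)
    fix e :: real assume e: "0 < e" "e < 1"
    have "norm (infsum (ct_term W A (\<lambda>_. one_minus_powr (of_real e)) arcmon) (support_class A E)) \<le> e ^ card S * C"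
      unfolding C_def
    proof (rule ct_term_infsum_bound[OF fin _ S(2) e])
      show "S \<subseteq> A" "support_class A E \<subseteq> A \<rightarrow>\<^sub>E UNIV" using S E by (auto simp: support_class_def)
      show "1 \<le> M s" if "M \<in> support_class A E" "s \<in> S" for M s
        using that S E by (auto simp: support_class_def Suc_le_eq)
    qed
    also have "\<dots> \<le> e ^ Suc m * C"
      using e S(3) C by (intro mult_right_mono power_decreasing) auto
    finally show "norm (infsum (ct_term W A (\<lambda>_. one_minus_powr (of_real e)) arcmon) (support_class A E) / of_real e ^ m) \<le> e * C"
      using e by (simp add: norm_divide norm_power divide_simps mult_ac)
  qed
next
  case False
  \<comment> \<open>Fewer than 2 m of the 2 m + 1 vertices are covered, so two are free and
    antisymmetry kills every term.\<close>
  have sub: "vertices E \<subseteq> {1..n}" using E(1) A by (fastforce simp: vertices_def)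
  then have "card ({1..n} - vertices E) = n - card (vertices E)"
    by (simp add: card_Diff_subset finite_subset)
  then have "2 \<le> card ({1..n} - vertices E)" using False n by linarith
  then obtain S where S: "S \<subseteq> {1..n} - vertices E" "card S = 2"
    using obtain_subset_with_card_n by metis
  then obtain p q where "S = {p, q}" "p \<noteq> q" by (auto simp: card_2_iff)
  with S have pq: "p \<in> {1..n} - vertices E" "q \<in> {1..n} - vertices E" "p \<noteq> q" by auto
  have "infsum (ct_term W A (\<lambda>_. one_minus_powr (of_real e)) arcmon) (support_class A E) = 0" for e
    by (rule infsum_0) (rule ct_term_eq_0[OF pq], auto simp: support_class_def)
  then show ?thesis by simp
qed

theorem shifted_limit:
  assumes fin: "finite A" and n: "n = 2 * m + 1" and A: "A \<subseteq> {1..n} \<times> {1..n}"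
    and loop: "\<And>s. s \<in> A \<Longrightarrow> fst s \<noteq> snd s" and opp: "\<And>s. s \<in> A \<Longrightarrow> prod.swap s \<notin> A"
  shows "((\<lambda>e. infsum (ct_term W A (\<lambda>_. one_minus_powr (of_real e)) arcmon) (A \<rightarrow>\<^sub>E UNIV) / of_real e ^ m)
    \<longlongrightarrow> (\<Sum>E | E \<subseteq> A \<and> matching E \<and> card E = m. logCT E)) (at_right 0)"
proof -
  let ?g = "\<lambda>e. ct_term W A (\<lambda>_. one_minus_powr (of_real e)) arcmon"
  have lim: "((\<lambda>e. \<Sum>E\<in>Pow A. infsum (?g e) (support_class A E) / of_real e ^ m)
      \<longlongrightarrow> (\<Sum>E\<in>Pow A. if matching E \<and> card E = m then logCT E else 0)) (at_right 0)"
  proof (rule tendsto_sum)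
    fix E assume E: "E \<in> Pow A"
    show "((\<lambda>e. infsum (?g e) (support_class A E) / of_real e ^ m)
      \<longlongrightarrow> (if matching E \<and> card E = m then logCT E else 0)) (at_right 0)"
    proof (cases "matching E \<and> card E = m")
      case True
      have "arc_independent E" using True E fin loop finite_subset by (intro arc_independent_matching) blast+
      then show ?thesis using matching_limit[OF fin, of E] E True by auto
    next
      case False
      then show ?thesis using other_limit[OF fin n A loop opp, of E] E by auto
    qed
  qed
  have split: "(\<Sum>E\<in>Pow A. infsum (?g e) (support_class A E) / of_real e ^ m) =
      infsum (?g e) (A \<rightarrow>\<^sub>E UNIV) / of_real e ^ m" if e: "0 < e" "e < 1" for e
  proof -
    have "(\<Sum>E\<in>Pow A. infsum (?g e) (support_class A E)) = infsum (?g e) (\<Union>E\<in>Pow A. support_class A E)"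
    proof (rule sum_infsum)
      show "?g e summable_on support_class A E" for E
        using abs_summable_summable[OF ct_term_abs_summable[OF fin e]]
        by (rule summable_on_subset_banach) (auto simp: support_class_def)
    qed (use fin in \<open>auto simp: support_class_def\<close>)
    also have "(\<Union>E\<in>Pow A. support_class A E) = A \<rightarrow>\<^sub>E UNIV"
    proof (intro equalityI subsetI)
      fix M :: "nat \<times> nat \<Rightarrow> nat" assume "M \<in> A \<rightarrow>\<^sub>E UNIV"
      then have "M \<in> support_class A {s \<in> A. M s \<noteq> 0}" by (auto simp: support_class_def)
      then show "M \<in> (\<Union>E\<in>Pow A. support_class A E)" by (rule UN_I[rotated]) auto
    qed (auto simp: support_class_def)
    finally show ?thesis by (simp flip: sum_divide_distrib)
  qed
  have "(\<Sum>E\<in>Pow A. if matching E \<and> card E = m then logCT E else 0) = (\<Sum>E | E \<subseteq> A \<and> matching E \<and> card E = m. logCT E)"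
    using fin by (subst sum.inter_filter[symmetric]) (auto intro!: sum.cong)
  moreover have "\<forall>\<^sub>F e in at_right 0. (\<Sum>E\<in>Pow A. infsum (?g e) (support_class A E) / of_real e ^ m) =
      infsum (?g e) (A \<rightarrow>\<^sub>E UNIV) / of_real e ^ m"
    using split unfolding eventually_at_right_field by (intro exI[of _ 1]) auto
  ultimately show ?thesis
    using Lim_transform_eventually[OF lim] by simp
qed

end

section \<open>Near-perfect matchings\<close>

lemma vertices_image: "vertices (map_prod f f ` E) = f ` vertices E"
  by (auto simp: vertices_def)

lemma touch_subset_vertices: "s \<in> E \<Longrightarrow> touch s \<subseteq> vertices E"
  unfolding vertices_def by (rule UN_upper)

lemma touch_map_prod: "touch (map_prod f f s) = f ` touch s"
  by (cases s) simp

text \<open>Only the endpoint sets have to be moved by \<open>f\<close>, so the lemma also covers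
  maps such as \<open>twin_swap\<close>, which reverse some arcs.\<close>

lemma matching_image:
  assumes "matching E" "\<And>s. s \<in> E \<Longrightarrow> touch (g s) = f ` touch s" "inj f"
  shows "matching (g ` E)"
  unfolding matching_def
proof (intro ballI impI)
  fix s t assume "s \<in> g ` E" "t \<in> g ` E" "s \<noteq> t"
  then obtain s' t' where st: "s' \<in> E" "t' \<in> E" "s = g s'" "t = g t'" "s' \<noteq> t'" by auto
  then have "touch s' \<inter> touch t' = {}" using assms(1) by (simp add: matching_def)
  then have "f ` touch s' \<inter> f ` touch t' = {}"
    using assms(3) by (metis image_Int image_empty)
  then show "touch s \<inter> touch t = {}"
    using assms(2)[OF st(1)] assms(2)[OF st(2)] st(3,4) by simp
qed

lemma card_vertices_matching:
  assumes "finite E" "matching E" "\<And>s. s \<in> E \<Longrightarrow> fst s \<noteq> snd s"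
  shows "card (vertices E) = 2 * card E"
proof -
  have "card (vertices E) = (\<Sum>s\<in>E. card (touch s))"
    unfolding vertices_def using assms by (intro card_UN_disjoint) (auto simp: matching_def)
  also have "\<dots> = (\<Sum>s\<in>E. 2)"
    using assms(3) by (intro sum.cong refl) (simp add: card_insert_if)
  finally show ?thesis by simp
qed

text \<open>The arcs \<open>(p, q)\<close> for which the factor attached to \<open>{p, q}\<close> is expanded in powers of
  \<open>x\<^sub>p / x\<^sub>q\<close>. They form a regular tournament: \<open>q\<close> is one of the \<open>m\<close> cyclic successors of \<open>p\<close>.\<close>

definition arcs :: "nat \<Rightarrow> (nat \<times> nat) set" where
  "arcs m = {(p, q). p \<in> {1..2 * m + 1} \<and> q \<in> {1..2 * m + 1} \<and> (p < q \<and> q \<le> p + m \<or> q + m < p)}"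

lemma arcs_subset: "arcs m \<subseteq> {1..2 * m + 1} \<times> {1..2 * m + 1}"
  by (auto simp: arcs_def)

lemma finite_arcs [simp]: "finite (arcs m)"
  by (rule finite_subset[OF arcs_subset]) simp

lemma arcs_loop: "s \<in> arcs m \<Longrightarrow> fst s \<noteq> snd s"
  by (auto simp: arcs_def)

lemma arcs_opp: "s \<in> arcs m \<Longrightarrow> prod.swap s \<notin> arcs m"
  by (auto simp: arcs_def)

definition near_perfect :: "nat \<Rightarrow> (nat \<times> nat) set set" where
  "near_perfect m = {E. E \<subseteq> arcs m \<and> matching E \<and> card E = m}"

lemma finite_near_perfect [simp]: "finite (near_perfect m)"
  by (rule finite_subset[of _ "Pow (arcs m)"]) (auto simp: near_perfect_def)

lemma near_perfectD:
  assumes "E \<in> near_perfect m"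
  shows "finite E" "vertices E \<subseteq> {1..2 * m + 1}" "card (vertices E) = 2 * m"
proof -
  have E: "E \<subseteq> arcs m" "matching E" "card E = m" using assms by (auto simp: near_perfect_def)
  show fin: "finite E" using E finite_subset finite_arcs by blast
  show "vertices E \<subseteq> {1..2 * m + 1}" using E arcs_subset by (fastforce simp: vertices_def)
  show "card (vertices E) = 2 * m" using card_vertices_matching[OF fin E(2)] E arcs_loop by auto
qed

section \<open>Cyclic rotation and the sign-reversing exchange of anti-twins\<close>

definition rotate_vertex :: "nat \<Rightarrow> nat \<Rightarrow> nat" where
  "rotate_vertex n i = (if i \<in> {1..<n} then Suc i else if i = n then 1 else i)"

lemma rotate_vertex_permutes:
  assumes "n \<ge> 1"
  shows "rotate_vertex n permutes {1..n}"
proof (rule bij_imp_permutes)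
  have inj: "inj_on (rotate_vertex n) {1..n}" by (auto simp: rotate_vertex_def inj_on_def split: if_splits)
  moreover have "rotate_vertex n ` {1..n} \<subseteq> {1..n}" using assms by (auto simp: rotate_vertex_def)
  ultimately show "bij_betw (rotate_vertex n) {1..n} {1..n}" by (simp add: bij_betw_def endo_inj_surj)
qed (use assms in \<open>auto simp: rotate_vertex_def\<close>)

text \<open>Only the last vertex, which moves to the front, causes inversions: one with each of the
  2 m others.\<close>

lemma inversion_sign_rotate_vertex: "inversion_sign (2 * m + 1) (rotate_vertex (2 * m + 1)) = 1"
proof -
  have "{(i, j) \<in> pairs (2 * m + 1). \<not> rotate_vertex (2 * m + 1) i < rotate_vertex (2 * m + 1) j} = {1..<2 * m + 1} \<times> {2 * m + 1}"
    by (auto simp: pairs_def rotate_vertex_def split: if_splits)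
  then show ?thesis by (simp add: inversion_sign_eq card_cartesian_product)
qed

lemma rotate_vertex_arcs: "map_prod (rotate_vertex (2 * m + 1)) (rotate_vertex (2 * m + 1)) ` arcs m = arcs m"
proof (rule endo_inj_surj)
  show "inj_on (map_prod (rotate_vertex (2 * m + 1)) (rotate_vertex (2 * m + 1))) (arcs m)"
    using permutes_inj[OF rotate_vertex_permutes, of "2 * m + 1"]
    by (intro inj_on_subset[OF prod.inj_map]) simp_all
  show "map_prod (rotate_vertex (2 * m + 1)) (rotate_vertex (2 * m + 1)) ` arcs m \<subseteq> arcs m"
  proof (rule image_subsetI)
    fix s assume s: "s \<in> arcs m"
    obtain p q where [simp]: "s = (p, q)" by force
    consider "p = 2 * m + 1" | "q = 2 * m + 1" "p \<noteq> q" | "p \<noteq> 2 * m + 1" "q \<noteq> 2 * m + 1" by blast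
    then show "map_prod (rotate_vertex (2 * m + 1)) (rotate_vertex (2 * m + 1)) s \<in> arcs m"
      using s by cases (auto simp: arcs_def rotate_vertex_def)
  qed
qed simp

text \<open>\<open>p = t + 1\<close> and \<open>q = m + t + 1\<close> are anti-twins: any other vertex in question is a successor of one
  and a predecessor of the other. So exchanging them in a matching and reversing
  the two arcs concerned gives a matching again, with the opposite contribution.\<close>

definition twin_swap :: "nat \<Rightarrow> nat \<Rightarrow> nat \<times> nat \<Rightarrow> nat \<times> nat" where
  "twin_swap p q s = (if p \<in> touch s \<or> q \<in> touch s
     then prod.swap (map_prod (Transposition.transpose p q) (Transposition.transpose p q) s) else s)"

lemma touch_twin_swap: "touch (twin_swap p q s) = Transposition.transpose p q ` touch s"
  by (cases s) (auto simp: twin_swap_def transpose_apply_other)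

lemma twin_swap_twin_swap: "twin_swap p q (twin_swap p q s) = s"
proof (cases "p \<in> touch s \<or> q \<in> touch s")
  case True
  then have "p \<in> touch (twin_swap p q s) \<or> q \<in> touch (twin_swap p q s)"
    unfolding touch_twin_swap by force
  with True show ?thesis by (cases s) (simp add: twin_swap_def)
qed (simp add: twin_swap_def)

text \<open>These sets interpolate between all near-perfect matchings missing the last vertex, at t
  = 0, and the single matching of the arcs (i, m + i), at t = m.\<close>

definition partial_perfect :: "nat \<Rightarrow> nat \<Rightarrow> (nat \<times> nat) set set" where
  "partial_perfect m t =
    {E \<in> near_perfect m. 2 * m + 1 \<notin> vertices E \<and> (\<forall>i\<in>{1..t}. (i, m + i) \<in> E)}"

lemma twin_swap_partial_perfect:
  assumes E: "E \<in> partial_perfect m t" and t: "t < m" and no: "(t + 1, m + t + 1) \<notin> E"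
  defines "p \<equiv> t + 1" and "q \<equiv> m + t + 1"
  shows "twin_swap p q ` E \<in> partial_perfect m t" "(p, q) \<notin> twin_swap p q ` E"
proof -
  let ?h = "twin_swap p q"
  have E': "E \<subseteq> arcs m" "matching E" "card E = m" "2 * m + 1 \<notin> vertices E"
    "\<And>i. i \<in> {1..t} \<Longrightarrow> (i, m + i) \<in> E"
    using E by (auto simp: partial_perfect_def near_perfect_def)
  have inj: "inj ?h" by (metis injI twin_swap_twin_swap)
  have arcs: "?h s \<in> arcs m" if s: "s \<in> E" for s
  proof (cases "p \<in> touch s \<or> q \<in> touch s")
    case True
    obtain x y where [simp]: "s = (x, y)" by force
    have xy: "(x, y) \<in> arcs m" using s E'(1) by auto
    have "touch s \<subseteq> vertices E" using s by (rule touch_subset_vertices)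
    then have ne: "x \<noteq> 2 * m + 1" "y \<noteq> 2 * m + 1" using E'(4) by auto
    \<comment> \<open>An arc at \<open>p\<close> or \<open>q\<close> is none of the prescribed arcs
      (i, m + i), so in a matching it avoids their ends.\<close>
    have old: "x \<noteq> i \<and> y \<noteq> i \<and> x \<noteq> m + i \<and> y \<noteq> m + i" if i: "i \<in> {1..t}" for i
    proof -
      have "s \<noteq> (i, m + i)" using True i t by (auto simp: p_def q_def)
      then have "touch s \<inter> touch (i, m + i) = {}"
        using E'(2) s E'(5)[OF i] unfolding matching_def by blast
      then show ?thesis by auto
    qed
    have range: "x \<notin> {1..t}" "y \<notin> {1..t}" "x \<notin> {m + 1..m + t}" "y \<notin> {m + 1..m + t}"
    proof -
      show "x \<notin> {1..t}" "y \<notin> {1..t}" using old[of x] old[of y] by auto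
      show "x \<notin> {m + 1..m + t}"
      proof
        assume "x \<in> {m + 1..m + t}"
        then have "x - m \<in> {1..t}" "x = m + (x - m)" by auto
        with old[of "x - m"] show False by blast
      qed
      show "y \<notin> {m + 1..m + t}"
      proof
        assume "y \<in> {m + 1..m + t}"
        then have "y - m \<in> {1..t}" "y = m + (y - m)" by auto
        with old[of "y - m"] show False by blast
      qed
    qed
    have npq: "(x, y) \<noteq> (p, q)" using no s by (auto simp: p_def q_def)
    \<comment> \<open>A remaining vertex other than \<open>p\<close> and \<open>q\<close> either
      lies between them, following \<open>p\<close> and preceding \<open>q\<close>, or lies beyond
      \<open>q\<close>, preceding \<open>p\<close> and following \<open>q\<close>. Exchanging
      \<open>p\<close> and \<open>q\<close> and reversing the arc therefore gives an arc
      again.\<close>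
    consider "x = p" "y \<noteq> q" | "x = q" | "y = p" "x \<noteq> q" | "y = q" "x \<noteq> p"
      using True npq by auto
    then show ?thesis
      using xy ne range t npq
      by cases (auto simp: twin_swap_def Transposition.transpose_def arcs_def p_def q_def)
  qed (use s E'(1) in \<open>auto simp: twin_swap_def\<close>)
  have vs: "vertices (?h ` E) = Transposition.transpose p q ` vertices E"
    unfolding vertices_def by (simp only: image_UN image_image touch_twin_swap UN_simps)
  have "?h ` E \<in> near_perfect m"
    unfolding near_perfect_def
    using arcs matching_image[OF E'(2) touch_twin_swap, of p q] E'(3) inj
    by (auto simp: card_image inj_on_subset)
  moreover have "2 * m + 1 \<notin> vertices (?h ` E)"
  proof
    assume "2 * m + 1 \<in> vertices (?h ` E)"
    then obtain v where "v \<in> vertices E" "2 * m + 1 = Transposition.transpose p q v"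
      unfolding vs by blast
    with E'(4) t show False
      by (auto simp: Transposition.transpose_def p_def q_def split: if_splits)
  qed
  moreover have "(i, m + i) \<in> ?h ` E" if "i \<in> {1..t}" for i
  proof -
    have "?h (i, m + i) = (i, m + i)" using that t by (auto simp: twin_swap_def p_def q_def)
    then show ?thesis using E'(5)[OF that] by (metis imageI)
  qed
  ultimately show "?h ` E \<in> partial_perfect m t" by (simp add: partial_perfect_def)
  show "(p, q) \<notin> ?h ` E"
  proof
    assume "(p, q) \<in> ?h ` E"
    then obtain s where "s \<in> E" "?h s = (p, q)" by auto
    then have "?h (p, q) \<in> E" by (metis twin_swap_twin_swap)
    then show False using no by (simp add: twin_swap_def p_def q_def)
  qed
qed

lemma partial_perfect_vertices:
  assumes "E \<in> partial_perfect m t"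
  shows "vertices E = {1..2 * m}"
proof (rule card_subset_eq)
  have E: "E \<in> near_perfect m" "2 * m + 1 \<notin> vertices E" using assms by (auto simp: partial_perfect_def)
  show "vertices E \<subseteq> {1..2 * m}"
  proof
    fix v assume v: "v \<in> vertices E"
    then have "v \<in> {1..2 * m + 1}" "v \<noteq> 2 * m + 1" using near_perfectD(2)[OF E(1)] E(2) by auto
    then show "v \<in> {1..2 * m}" by auto
  qed
  show "card (vertices E) = card {1..2 * m}" using near_perfectD(3)[OF E(1)] by simp
qed simp

context antisymmetric
begin

text \<open>Three signs: one from the transposition and one from each of the two reversed
  arcs.\<close>

lemma logCT_twin_swap:
  assumes n: "n = 2 * m + 1" and E: "E \<in> partial_perfect m t" and t: "t < m" and no: "(t + 1, m + t + 1) \<notin> E"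
  defines "p \<equiv> t + 1" and "q \<equiv> m + t + 1"
  shows "logCT (twin_swap p q ` E) = - logCT E"
proof -
  let ?\<pi> = "Transposition.transpose p q"
  let ?r = "map_prod ?\<pi> ?\<pi>"
  have E': "E \<subseteq> arcs m" "matching E"
    using E by (auto simp: partial_perfect_def near_perfect_def)
  have pq: "p \<in> {1..n}" "q \<in> {1..n}" "p \<noteq> q" using t n by (auto simp: p_def q_def)
  have "p \<in> vertices E" "q \<in> vertices E" using partial_perfect_vertices[OF E] t by (auto simp: p_def q_def)
  then obtain a b where ab: "a \<in> E" "p \<in> touch a" "b \<in> E" "q \<in> touch b" by (auto simp: vertices_def)
  \<comment> \<open>No arc of \<open>E\<close> joins \<open>p\<close> and \<open>q\<close>: one
    direction is excluded by assumption, the other is not an arc. So they lie on two different arcs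
    of \<open>E\<close>.\<close>
  have "(q, p) \<notin> arcs m" by (auto simp: p_def q_def arcs_def)
  then have neq: "a \<noteq> b"
    using ab E'(1) no pq(3) by (cases a) (auto simp: p_def q_def)
  define R where "R = E - {a, b}"
  have R: "touch a \<inter> vertices R = {}" "touch b \<inter> vertices R = {}" "touch a \<inter> touch b = {}"
    using E'(2) ab neq unfolding matching_def R_def vertices_def by blast+
  have ER: "E = insert a (insert b R)" using ab by (auto simp: R_def)
  have idR: "?r s = s" "twin_swap p q s = s" if "s \<in> R" for s
  proof -
    have "touch s \<subseteq> vertices R" using that by (rule touch_subset_vertices)
    then have "p \<notin> touch s" "q \<notin> touch s" using R ab by auto
    then show "?r s = s" "twin_swap p q s = s"
      by (cases s; auto simp: transpose_apply_other twin_swap_def)+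
  qed
  have imR: "?r ` R = R" "twin_swap p q ` R = R" using idR by force+
  have sw: "twin_swap p q a = prod.swap (?r a)" "twin_swap p q b = prod.swap (?r b)"
    using ab by (simp_all add: twin_swap_def)
  have perm: "?\<pi> permutes {1..n}" using pq by (intro permutes_swap_id) auto
  have touch: "touch (?r a) = ?\<pi> ` touch a" "touch (?r b) = ?\<pi> ` touch b"
    by (rule touch_map_prod)+
  have vsR: "vertices R = ?\<pi> ` vertices R"
    using vertices_image[of ?\<pi> R] unfolding imR(1) .
  have disj: "?\<pi> ` X \<inter> ?\<pi> ` Y = {}" if "X \<inter> Y = {}" for X Y
    using that image_Int[OF permutes_inj[OF perm], of X Y] by simp
  have dis: "touch (?r a) \<inter> vertices R = {}" "touch (?r b) \<inter> vertices R = {}" "touch (?r a) \<inter> touch (?r b) = {}"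
    using disj[OF R(1)] disj[OF R(2)] disj[OF R(3)] unfolding touch vsR[symmetric] .
  have mem: "fst (?r s) \<in> {1..n}" "snd (?r s) \<in> {1..n}" "fst (?r s) \<noteq> snd (?r s)" if "s \<in> E" for s
  proof -
    have "s \<in> arcs m" using that E' by auto
    then have "fst s \<in> {1..n}" "snd s \<in> {1..n}" "fst s \<noteq> snd s"
      using n by (auto simp: arcs_def)
    then show "fst (?r s) \<in> {1..n}" "snd (?r s) \<in> {1..n}" "fst (?r s) \<noteq> snd (?r s)"
      using permutes_in_image[OF perm] permutes_inj[OF perm] by (auto simp: inj_eq)
  qed
  \<comment> \<open>The arcs are reversed one at a time: first that of \<open>b\<close> while that
    of \<open>a\<close> is still unreversed, then that of \<open>a\<close>.\<close>
  let ?C = "insert (prod.swap (?r b)) R"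
  have "touch (?r a) \<inter> vertices ?C = {}" "touch (?r b) \<inter> vertices (insert (?r a) R) = {}"
    using dis by (auto simp: vertices_def)
  note rev = logCT_reverse[OF mem[OF ab(1)] this(1)] logCT_reverse[OF mem[OF ab(3)] this(2)]
  have h: "twin_swap p q ` E = insert (prod.swap (?r a)) ?C"
    by (simp add: ER imR sw)
  have "?r ` E = insert (?r b) (insert (?r a) R)"
    by (simp only: ER image_insert imR insert_commute)
  then have "logCT (insert (?r b) (insert (?r a) R)) = - logCT E"
    using logCT_perm[OF perm, of E] inversion_sign_transpose_neq[OF pq] by simp
  then show ?thesis
    unfolding h rev(1) insert_commute[of "?r a" "prod.swap (?r b)"] rev(2) by simp
qed

text \<open>On the matchings lacking the arc (t + 1, m + t + 1), \<open>twin_swap\<close> acts as a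
  sign-reversing involution, so their sum equals its own negative.\<close>

lemma sum_partial_perfect_Suc:
  assumes n: "n = 2 * m + 1" and t: "t < m"
  shows "(\<Sum>E\<in>partial_perfect m t. logCT E) = (\<Sum>E\<in>partial_perfect m (Suc t). logCT E)"
proof -
  let ?B = "{E \<in> partial_perfect m t. (t + 1, m + t + 1) \<notin> E}"
  let ?h = "\<lambda>E. twin_swap (t + 1) (m + t + 1) ` E"
  have fin: "finite (partial_perfect m t)" "finite (partial_perfect m (Suc t))"
    by (auto simp: partial_perfect_def)
  have "(\<Sum>E\<in>?B. logCT E) = (\<Sum>E\<in>?B. logCT (?h E))"
    by (rule sum.reindex_bij_witness[of _ ?h ?h])
      (use twin_swap_partial_perfect[OF _ t] in \<open>auto simp: image_image twin_swap_twin_swap\<close>)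
  also have "\<dots> = (\<Sum>E\<in>?B. - logCT E)"
    using logCT_twin_swap[OF n _ t] by (intro sum.cong) auto
  finally have B: "(\<Sum>E\<in>?B. logCT E) = 0" by (simp add: sum_negf)
  have "{1..Suc t} = insert (Suc t) {1..t}" by auto
  then have "partial_perfect m t = ?B \<union> partial_perfect m (Suc t)" "?B \<inter> partial_perfect m (Suc t) = {}"
    by (auto simp: partial_perfect_def)
  then show ?thesis
    using B fin by (metis (no_types, lifting) add_0 finite_Un sum.union_disjoint)
qed

lemma sum_partial_perfect:
  assumes n: "n = 2 * m + 1"
  shows "(\<Sum>E\<in>partial_perfect m 0. logCT E) = logCT ((\<lambda>i. (i, m + i)) ` {1..m})"
proof -
  let ?E = "(\<lambda>i. (i, m + i)) ` {1..m}"
  have "t \<le> m \<Longrightarrow> (\<Sum>E\<in>partial_perfect m 0. logCT E) = (\<Sum>E\<in>partial_perfect m t. logCT E)" for t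
    by (induction t) (auto simp: sum_partial_perfect_Suc[OF n])
  from this[of m] have "(\<Sum>E\<in>partial_perfect m 0. logCT E) = (\<Sum>E\<in>partial_perfect m m. logCT E)" by simp
  moreover have "partial_perfect m m = {?E}"
  proof (intro equalityI subsetI)
    fix E assume "E \<in> partial_perfect m m"
    then have E: "E \<in> near_perfect m" and sub: "?E \<subseteq> E" by (auto simp: partial_perfect_def)
    then have "card E = m" "finite E" using near_perfectD(1)[OF E] by (simp_all add: near_perfect_def)
    moreover have "card ?E = m" by (simp add: card_image inj_on_def)
    ultimately show "E \<in> {?E}" using card_subset_eq[of E ?E] sub by simp
  next
    fix E assume "E \<in> {?E}"
    moreover have "card ?E = m" by (simp add: card_image inj_on_def)
    ultimately show "E \<in> partial_perfect m m"
      by (auto simp: partial_perfect_def near_perfect_def arcs_def matching_def vertices_def)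
  qed
  ultimately show ?thesis by simp
qed

text \<open>Rotation preserves the arcs and is even, so missing \<open>v\<close> and missing
  \<open>Suc v\<close> give the same sum; the induction runs up to the last vertex.\<close>

lemma sum_missing_vertex:
  assumes n: "n = 2 * m + 1" and v: "v \<in> {1..n}"
  shows "(\<Sum>E | E \<in> near_perfect m \<and> v \<notin> vertices E. logCT E) = (\<Sum>E\<in>partial_perfect m 0. logCT E)"
  using v
proof (induction "n - v" arbitrary: v)
  case 0
  then have "v = 2 * m + 1" using n by simp
  then show ?case by (simp add: partial_perfect_def)
next
  case (Suc d)
  let ?r = "map_prod (rotate_vertex n) (rotate_vertex n)"
  have perm: "rotate_vertex n permutes {1..n}" using n by (intro rotate_vertex_permutes) auto
  have injr: "inj (rotate_vertex n)" by (rule permutes_inj[OF perm])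
  then have inj: "inj ?r" by (simp add: prod.inj_map)
  have rv: "rotate_vertex n v = Suc v" using Suc by (auto simp: rotate_vertex_def)
  have A: "?r ` arcs m = arcs m" using rotate_vertex_arcs[of m] n by simp
  have matching_iff: "matching (?r ` E) \<longleftrightarrow> matching E" for E
  proof
    have "matching (inv ?r ` ?r ` E)" if "matching (?r ` E)"
    proof (rule matching_image[OF that])
      fix s assume "s \<in> ?r ` E"
      then obtain t where "s = ?r t" by auto
      then show "touch (inv ?r s) = inv (rotate_vertex n) ` touch s"
        by (simp only: touch_map_prod inv_f_f[OF inj] image_inv_f_f[OF injr])
    qed (rule permutes_inj[OF permutes_inv[OF perm]])
    then show "matching (?r ` E) \<Longrightarrow> matching E" using inj by (simp add: image_image)
    show "matching E \<Longrightarrow> matching (?r ` E)"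
      by (rule matching_image[OF _ touch_map_prod injr])
  qed
  have "(\<Sum>E | E \<in> near_perfect m \<and> v \<notin> vertices E. logCT E) = (\<Sum>E | E \<in> near_perfect m \<and> v \<notin> vertices E. logCT (?r ` E))"
    using logCT_perm[OF perm] inversion_sign_rotate_vertex[of m] n by simp
  also have "\<dots> = (\<Sum>E | E \<in> near_perfect m \<and> Suc v \<notin> vertices E. logCT E)"
  proof (rule sum.reindex_bij_betw)
    show "bij_betw (\<lambda>E. ?r ` E) {E \<in> near_perfect m. v \<notin> vertices E} {E \<in> near_perfect m. Suc v \<notin> vertices E}"
      unfolding bij_betw_def
    proof (intro conjI equalityI subsetI)
      show "inj_on (\<lambda>E. ?r ` E) {E \<in> near_perfect m. v \<notin> vertices E}"
        by (rule inj_on_image[OF inj_on_subset[OF inj subset_UNIV]])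
    next
      fix E assume "E \<in> (\<lambda>E. ?r ` E) ` {E \<in> near_perfect m. v \<notin> vertices E}"
      then obtain E' where E': "E' \<in> near_perfect m" "v \<notin> vertices E'" "E = ?r ` E'" by auto
      then have "E' \<subseteq> arcs m" "matching E'" "card E' = m" by (auto simp: near_perfect_def)
      then have "E \<subseteq> arcs m" "matching E" "card E = m"
        using A E'(3) inj by (auto simp: matching_iff card_image inj_on_subset)
      moreover have "Suc v \<notin> vertices E"
        using E'(2,3) injr by (simp add: vertices_image flip: rv) (auto dest: injD)
      ultimately show "E \<in> {E \<in> near_perfect m. Suc v \<notin> vertices E}" by (simp add: near_perfect_def)
    next
      fix E assume E: "E \<in> {E \<in> near_perfect m. Suc v \<notin> vertices E}"
      then have "E \<subseteq> ?r ` arcs m" using A by (simp add: near_perfect_def)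
      then obtain E' where E': "E' \<subseteq> arcs m" "E = ?r ` E'" by (meson subset_imageE)
      then have "matching E'" "card E' = m"
        using E inj by (auto simp: near_perfect_def matching_iff card_image inj_on_subset)
      moreover have "v \<notin> vertices E'"
        using E E' by (auto simp: vertices_image simp flip: rv)
      ultimately show "E \<in> (\<lambda>E. ?r ` E) ` {E \<in> near_perfect m. v \<notin> vertices E}"
        using E' by (intro image_eqI[of _ _ E']) (auto simp: near_perfect_def)
    qed
  qed
  also have "\<dots> = (\<Sum>E\<in>partial_perfect m 0. logCT E)"
    using Suc by (intro Suc.hyps(1)) auto
  finally show ?case .
qed

text \<open>Every near-perfect matching misses exactly one vertex; sorting by that vertex gives
  \<open>n\<close> equal sums.\<close>

lemma sum_near_perfect:
  assumes n: "n = 2 * m + 1"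
  shows "(\<Sum>E\<in>near_perfect m. logCT E) = of_nat n * logCT ((\<lambda>i. (i, m + i)) ` {1..m})"
proof -
  have "(\<Sum>E\<in>near_perfect m. logCT E) = (\<Sum>E\<in>near_perfect m. \<Sum>v\<in>{1..n} - vertices E. logCT E)"
  proof (intro sum.cong refl)
    fix E assume "E \<in> near_perfect m"
    then have "card ({1..n} - vertices E) = 1"
      using near_perfectD[of E m] n by (simp add: card_Diff_subset finite_subset[of "vertices E"])
    then show "logCT E = (\<Sum>v\<in>{1..n} - vertices E. logCT E)" by simp
  qed
  also have "\<dots> = (\<Sum>E\<in>near_perfect m. \<Sum>v | v \<in> {1..n} \<and> v \<notin> vertices E. logCT E)"
    by (intro sum.cong) auto
  also have "\<dots> = (\<Sum>v\<in>{1..n}. \<Sum>E | E \<in> near_perfect m \<and> v \<notin> vertices E. logCT E)"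
    by (rule sum.swap_restrict) auto
  also have "\<dots> = (\<Sum>v\<in>{1..n}. logCT ((\<lambda>i. (i, m + i)) ` {1..m}))"
    by (intro sum.cong refl) (simp only: sum_missing_vertex[OF n] sum_partial_perfect[OF n])
  finally show ?thesis by simp
qed

end

text \<open>The permutation carrying the arcs \<open>(2 i, 2 i - 1)\<close> to \<open>(i, m + i)\<close>. It has as many inversions as
  there are signatures \<open>- 1\<close>, and for this reason the signs cancel in the end.\<close>

definition shuffle :: "nat \<Rightarrow> nat \<Rightarrow> nat" where
  "shuffle m j = (if j \<in> {1..2 * m} then if even j then j div 2 else m + (j + 1) div 2 else j)"

lemma shuffle_permutes: "shuffle m permutes {1..2 * m + 1}"
proof (rule bij_imp_permutes)
  have "inj_on (shuffle m) {1..2 * m + 1}"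
  proof (rule inj_onI)
    fix i j assume "i \<in> {1..2 * m + 1}" "j \<in> {1..2 * m + 1}" "shuffle m i = shuffle m j"
    then show "i = j"
      by (auto simp: shuffle_def split: if_splits elim!: evenE oddE)
  qed
  moreover have "shuffle m ` {1..2 * m + 1} \<subseteq> {1..2 * m + 1}"
    by (auto simp: shuffle_def)
  ultimately show "bij_betw (shuffle m) {1..2 * m + 1} {1..2 * m + 1}"
    by (simp add: bij_betw_def endo_inj_surj)
qed (auto simp: shuffle_def)

text \<open>Even labels fill the lower half and odd labels the upper half, each in increasing
  order.\<close>

lemma shuffle_inversion:
  assumes "1 \<le> i" "i < j" "j \<le> 2 * m + 1"
  shows "\<not> shuffle m i < shuffle m j \<longleftrightarrow> odd i \<and> even j"
proof (cases "even i"; cases "even j")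
  assume "odd i" "even j"
  then show ?thesis using assms by (auto simp: shuffle_def elim!: evenE oddE)
next
  assume "even i" "even j"
  then show ?thesis using assms by (auto simp: shuffle_def elim!: evenE)
next
  assume "even i" "odd j"
  then show ?thesis using assms by (auto simp: shuffle_def elim!: evenE oddE)
next
  assume "odd i" "odd j"
  then show ?thesis using assms by (auto simp: shuffle_def elim!: oddE)
qed

text \<open>With j' = j - m - 1, the condition m + i < j becomes i \<le> j' \<le> m, and the
  inversions are exactly the pairs (2 i - 1, 2 j') with such i and j'.\<close>

lemma inversion_sign_shuffle:
  "inversion_sign (2 * m + 1) (shuffle m) = (- 1) ^ card {(i, j) \<in> pairs (2 * m + 1). m + i < j}"
proof -
  have inv: "{(i, j) \<in> pairs (2 * m + 1). \<not> shuffle m i < shuffle m j} =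
      {(i, j) \<in> pairs (2 * m + 1). odd i \<and> even j}"
    using shuffle_inversion by (auto simp: pairs_def)
  have "bij_betw (\<lambda>(i, j). (2 * i - 1, 2 * (j - m - 1))) {(i, j) \<in> pairs (2 * m + 1). m + i < j}
      {(i, j) \<in> pairs (2 * m + 1). \<not> shuffle m i < shuffle m j}"
    unfolding inv
  proof (rule bij_betwI[where g = "\<lambda>(i, j). ((i + 1) div 2, j div 2 + m + 1)"], goal_cases)
    case 1
    then show ?case by (auto simp: pairs_def)
  next
    case 2
    then show ?case by (auto simp: pairs_def elim!: evenE oddE)
  next
    case (3 s)
    then show ?case by (auto simp: pairs_def)
  next
    case (4 s)
    then show ?case by (auto simp: pairs_def elim!: evenE oddE)
  qed
  then show ?thesis by (simp add: inversion_sign_eq bij_betw_same_card)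
qed

context antisymmetric
begin

lemma logCT_shuffle:
  assumes n: "n = 2 * m + 1"
  shows "logCT ((\<lambda>i. (i, m + i)) ` {1..m}) = (- 1) ^ card {(i, j) \<in> pairs n. m + i < j} *
    logCT ((\<lambda>i. (2 * i, 2 * i - 1)) ` {1..m})"
proof -
  let ?A = "(\<lambda>i. (2 * i, 2 * i - 1)) ` {1..m}"
  have perm: "shuffle m permutes {1..n}" using shuffle_permutes[of m] n by simp
  have "map_prod (shuffle m) (shuffle m) ` ?A = (\<lambda>i. (i, m + i)) ` {1..m}"
    unfolding image_image by (intro image_cong) (auto simp: shuffle_def)
  then show ?thesis
    using logCT_perm[OF perm, of ?A] inversion_sign_shuffle[of m, folded n] by simp
qed

end

section \<open>The leading coefficient of the closed form\<close>

lemma dfact_0 [simp]: "dfact 0 = 1" and dfact_m1 [simp]: "dfact (- 1) = 1"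
  by (simp_all add: dfact_def)

text \<open>The case N = -1 matters: it starts the odd double factorials, and for n = 1 it covers (n
  - 2)!!.\<close>

lemma dfact_add2:
  assumes "N \<ge> - 1"
  shows "dfact (N + 2) = (N + 2) * dfact N"
proof -
  have "{l. l \<in> {1..N + 2} \<and> even (N + 2 - l)} = insert (N + 2) {l. l \<in> {1..N} \<and> even (N - l)}"
  proof (intro set_eqI)
    fix l
    show "l \<in> {l. l \<in> {1..N + 2} \<and> even (N + 2 - l)} \<longleftrightarrow> l \<in> insert (N + 2) {l. l \<in> {1..N} \<and> even (N - l)}"
      using assms by (cases "l = N + 1") auto
  qed
  moreover have "finite {l. l \<in> {1..N} \<and> even (N - l)}"
    by (rule finite_subset[of _ "{1..N}"]) auto
  ultimately show ?thesis by (simp add: dfact_def)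
qed

lemma dfact_pos: "dfact N > 0"
  by (auto simp: dfact_def intro!: prod_pos)

lemma dfact_nonzero [simp]: "dfact N \<noteq> 0"
  using dfact_pos[of N] by simp

lemma not_nonpos_Ints_if_Re_pos: "Re z > 0 \<Longrightarrow> z \<notin> \<int>\<^sub>\<le>\<^sub>0"
proof
  assume "Re z > 0" "z \<in> \<int>\<^sub>\<le>\<^sub>0"
  then obtain i where "z = of_int i" "i \<le> 0" by (auto elim!: nonpos_Ints_cases)
  with \<open>Re z > 0\<close> show False by simp
qed

lemma Gamma_half_odd:
  "Gamma (1 + of_nat (2 * j + 1) / 2 :: complex) =
    of_int (dfact (int (2 * j + 1))) * of_real (sqrt pi) / 2 ^ Suc j"
proof (induction j)
  case 0
  have "Gamma (1 / 2 + 1 :: complex) = 1 / 2 * Gamma (1 / 2)"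
    by (rule Gamma_plus1) auto
  then show ?case
    using dfact_add2[of "- 1"] by (simp add: Gamma_one_half_complex add.commute)
next
  case (Suc j)
  have eq: "1 + of_nat (2 * Suc j + 1) / 2 = (1 + of_nat (2 * j + 1) / 2 :: complex) + 1"
    by (simp add: field_simps)
  have "(1 + of_nat (2 * j + 1) / 2 :: complex) \<notin> \<int>\<^sub>\<le>\<^sub>0"
    by (rule not_nonpos_Ints_if_Re_pos) (simp add: add_pos_nonneg)
  then have "Gamma (1 + of_nat (2 * Suc j + 1) / 2 :: complex) =
      (1 + of_nat (2 * j + 1) / 2) * Gamma (1 + of_nat (2 * j + 1) / 2)"
    unfolding eq by (rule Gamma_plus1)
  also have "\<dots> = (1 + of_nat (2 * j + 1) / 2) * (of_int (dfact (int (2 * j + 1))) * of_real (sqrt pi) / 2 ^ Suc j)"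
    using Suc.IH by simp
  also have "\<dots> = of_int ((int (2 * j + 1) + 2) * dfact (int (2 * j + 1))) * of_real (sqrt pi) / 2 ^ Suc (Suc j)"
    by (simp add: field_simps)
  also have "(int (2 * j + 1) + 2) * dfact (int (2 * j + 1)) = dfact (int (2 * Suc j + 1))"
    using dfact_add2[of "int (2 * j + 1)"] by (simp add: algebra_simps)
  finally show ?case .
qed

text \<open>Doubling each factor 1 + N/2 + l gives N + 2 + 2 l. Both parities of \<open>N\<close>
  occur, as \<open>N\<close> will be i * K.\<close>

lemma pochhammer_half:
  "pochhammer (1 + of_nat N / 2 :: complex) a = of_int (dfact (int (2 * a + N))) / (of_int (dfact (int N)) * 2 ^ a)"
proof (induction a)
  case (Suc a)
  have "pochhammer (1 + of_nat N / 2 :: complex) (Suc a) =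
      of_int ((int (2 * a + N) + 2) * dfact (int (2 * a + N))) / (of_int (dfact (int N)) * 2 ^ Suc a)"
    using Suc by (simp add: pochhammer_Suc field_simps)
  also have "(int (2 * a + N) + 2) * dfact (int (2 * a + N)) = dfact (int (2 * Suc a + N))"
    using dfact_add2[of "int (2 * a + N)"] by (simp add: algebra_simps)
  finally show ?case .
qed simp

lemma prod_telescope:
  fixes f :: "nat \<Rightarrow> complex"
  assumes "\<And>i. f i \<noteq> 0"
  shows "(\<Prod>i<n. f (Suc i) / f i) = f n / f 0"
  using assms by (induction n) auto

lemma continuous_pochhammer:
  fixes f :: "'a::t2_space \<Rightarrow> complex"
  shows "continuous F f \<Longrightarrow> continuous F (\<lambda>x. pochhammer (f x) N)"
  unfolding pochhammer_prod by (intro continuous_intros)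

definition morris_rhs :: "nat \<Rightarrow> nat \<Rightarrow> complex poly \<Rightarrow> nat \<Rightarrow> nat \<Rightarrow> complex \<Rightarrow> complex" where
  "morris_rhs n m P a b u =
     cos (of_real pi * u / 2) ^ m * poly P ((cos (of_real pi * u / 2))\<^sup>2) *
          (Gamma (1 + of_nat n * u / 2) / Gamma (1 + u / 2) ^ n) *
          (\<Prod>i<n. pochhammer (1 + of_nat i * u / 2) (a + b) /
             (pochhammer (1 + of_nat i * u / 2) a * pochhammer (1 + of_nat i * u / 2) b))"

definition log_morris_rhs :: "nat \<Rightarrow> nat \<Rightarrow> nat \<Rightarrow> nat \<Rightarrow> complex" where
  "log_morris_rhs n K a b = 1 / of_int (dfact (int n)) *
            (\<Prod>i<n. of_int (dfact (int (2 * a + 2 * b + i * K)) * dfact (int ((i + 1) * K))) /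
               of_int (dfact (int (2 * a + i * K)) * dfact (int (2 * b + i * K)) * dfact (int K)))"

lemma cos_odd_half_pi: "cos (of_real pi * of_nat (2 * k + 1) / 2 :: complex) = 0"
  and sin_odd_half_pi: "sin (of_real pi * of_nat (2 * k + 1) / 2 :: complex) = (- 1) ^ k"
proof -
  have *: "of_real pi * of_nat (2 * k + 1) / 2 = (of_real (of_nat k * pi + pi / 2) :: complex)"
    by (simp add: field_simps)
  show "cos (of_real pi * of_nat (2 * k + 1) / 2 :: complex) = 0"
    unfolding * cos_of_real by (simp add: cos_add)
  show "sin (of_real pi * of_nat (2 * k + 1) / 2 :: complex) = (- 1) ^ k"
    unfolding * sin_of_real by (simp add: sin_add)
qed

text \<open>At the odd integer \<open>K\<close> the cosine has a simple zero with derivative -(pi/2)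
  (-1)^k, and the remaining factor \<open>g\<close> is continuous. The powers of pi/2 from the
  derivative cancel against those from the Gamma quotient.\<close>

lemma morris_rhs_limit:
  assumes n: "n = 2 * m + 1" and P: "poly P 0 = 1 / of_int (dfact (int n - 2))" and K: "K = 2 * k + 1"
  shows "((\<lambda>e::real. morris_rhs n m P a b (of_nat K + of_real e) / of_real e ^ m)
    \<longlongrightarrow> (- 1) ^ (m * (k + 1)) * of_nat n * log_morris_rhs n K a b) (at_right 0)"
proof -
  define x where "x = (\<lambda>u::complex. cos (of_real pi * u / 2))"
  define g where "g = (\<lambda>u::complex. poly P ((x u)\<^sup>2) *
          (Gamma (1 + of_nat n * u / 2) / Gamma (1 + u / 2) ^ n) *
          (\<Prod>i<n. pochhammer (1 + of_nat i * u / 2) (a + b) /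
             (pochhammer (1 + of_nat i * u / 2) a * pochhammer (1 + of_nat i * u / 2) b)))"
  let ?K = "of_nat K :: complex"
  let ?D = "\<lambda>N::nat. of_int (dfact (int N)) :: complex"
  have x0: "x ?K = 0" using cos_odd_half_pi[of k] by (simp add: x_def K)
  have emb: "((\<lambda>e::real. of_real e :: complex) \<longlongrightarrow> 0) (at_right 0)"
    by (intro tendsto_eq_intros) auto
  have emb': "filterlim (\<lambda>e::real. of_real e :: complex) (at 0) (at_right 0)"
    using emb by (intro filterlim_atI) (auto simp: eventually_at_filter)
  have dx: "(x has_field_derivative - ((of_real pi / 2) * (- 1) ^ k)) (at ?K)"
    unfolding x_def using sin_odd_half_pi[of k]
    by (auto intro!: derivative_eq_intros simp: K)
  then have "((\<lambda>h. (x (?K + h) - x ?K) / h) \<longlongrightarrow> - ((of_real pi / 2) * (- 1) ^ k)) (at 0)"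
    by (simp add: DERIV_def)
  from filterlim_compose[OF this emb']
  have lx: "((\<lambda>e::real. x (?K + of_real e) / of_real e) \<longlongrightarrow> - ((of_real pi / 2) * (- 1) ^ k)) (at_right 0)"
    by (simp add: x0)
  have nz: "(1 + of_nat i * ?K / 2) \<notin> \<int>\<^sub>\<le>\<^sub>0" for i
    by (rule not_nonpos_Ints_if_Re_pos) (simp add: add_pos_nonneg)
  have pz: "pochhammer (1 + of_nat i * ?K / 2) c \<noteq> 0" for i c
    using pochhammer_half[of "i * K" c] by simp
  have "isCont g ?K"
    unfolding g_def x_def
    using nz[of n] nz[of 1] pz
    by (intro continuous_intros isCont_Gamma continuous_pochhammer) (auto simp: Gamma_eq_zero_iff)
  then have "(g \<longlongrightarrow> g ?K) (nhds ?K)"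
    by (simp add: isCont_def tendsto_at_iff_tendsto_nhds)
  moreover have "((\<lambda>e::real. ?K + of_real e) \<longlongrightarrow> ?K) (at_right 0)"
    using tendsto_add[OF tendsto_const emb, of ?K] by simp
  ultimately have lg: "((\<lambda>e::real. g (?K + of_real e)) \<longlongrightarrow> g ?K) (at_right 0)"
    by (rule filterlim_compose)
  have lim: "((\<lambda>e::real. (x (?K + of_real e) / of_real e) ^ m * g (?K + of_real e))
      \<longlongrightarrow> (- ((of_real pi / 2) * (- 1) ^ k)) ^ m * g ?K) (at_right 0)"
    by (intro tendsto_mult tendsto_power lx lg)
  have lhs: "(\<lambda>e::real. (x (?K + of_real e) / of_real e) ^ m * g (?K + of_real e)) =
      (\<lambda>e. morris_rhs n m P a b (of_nat K + of_real e) / of_real e ^ m)"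
    by (simp add: fun_eq_iff morris_rhs_def g_def x_def power_divide mult.assoc)
  have rhs: "(- ((of_real pi / 2) * (- 1) ^ k)) ^ m * g ?K =
      (- 1) ^ (m * (k + 1)) * of_nat n * log_morris_rhs n K a b"
  proof -
    \<comment> \<open>A product of odd numbers is odd, so the half-integer formula applies to the
      numerator Gamma value as well.\<close>
    have nK: "n * K = 2 * (n * k + m) + 1" by (simp add: n K algebra_simps)
    have G1: "Gamma (1 + of_nat n * ?K / 2) = ?D (n * K) * of_real (sqrt pi) / 2 ^ (n * k + m + 1)"
      using Gamma_half_odd[of "n * k + m"] unfolding nK[symmetric] by simp
    have G2: "Gamma (1 + ?K / 2) = ?D K * of_real (sqrt pi) / 2 ^ (k + 1)"
      using Gamma_half_odd[of k] unfolding K[symmetric] by simp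
    have sq: "of_real (sqrt pi) ^ n = (of_real (sqrt pi) * of_real pi ^ m :: complex)"
    proof -
      have "sqrt pi ^ n = sqrt pi * pi ^ m" by (simp add: n power_mult)
      then show ?thesis by (metis of_real_mult of_real_power)
    qed
    have p2: "(2::complex) ^ ((k + 1) * n) = 2 ^ (n * k + m + 1) * 2 ^ m"
      by (simp add: n algebra_simps flip: power_add)
    have G: "Gamma (1 + of_nat n * ?K / 2) / Gamma (1 + ?K / 2) ^ n = ?D (n * K) / ?D K ^ n * (2 / of_real pi) ^ m"
      unfolding G1 G2 power_divide power_mult_distrib sq power_mult[symmetric] p2
      by (simp add: field_simps)
    have pi_m: "(- ((of_real pi / 2) * (- 1) ^ k)) ^ m * (2 / of_real pi) ^ m = ((- 1) ^ (m * (k + 1)) :: complex)"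
    proof -
      have "(- ((of_real pi / 2) * (- 1) ^ k)) ^ m * (2 / of_real pi) ^ m =
          ((- ((of_real pi / 2) * (- 1) ^ k)) * (2 / of_real pi) :: complex) ^ m"
        by (simp only: power_mult_distrib)
      also have "(- ((of_real pi / 2) * (- 1) ^ k)) * (2 / of_real pi) = ((- 1) ^ (k + 1) :: complex)"
        by simp
      finally show ?thesis by (simp only: power_mult[symmetric] mult.commute)
    qed
    have poch: "pochhammer (1 + of_nat i * ?K / 2) c = ?D (2 * c + i * K) / (?D (i * K) * 2 ^ c)" for i c
      using pochhammer_half[of "i * K" c] by simp
    have "(\<Prod>i<n. pochhammer (1 + of_nat i * ?K / 2) (a + b) /
             (pochhammer (1 + of_nat i * ?K / 2) a * pochhammer (1 + of_nat i * ?K / 2) b)) =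
        (\<Prod>i<n. ?D (2 * a + 2 * b + i * K) * ?D (i * K) / (?D (2 * a + i * K) * ?D (2 * b + i * K)))"
      unfolding poch by (intro prod.cong refl) (simp add: power_add field_simps)
    \<comment> \<open>Writing (nK)!! as a telescoping product gives each factor ((i+1)K)!! / (iK)!!,
      whose denominator cancels the (iK)!! left by the Pochhammer symbols.\<close>
    moreover have "?D (n * K) = (\<Prod>i<n. ?D (Suc i * K) / ?D (i * K))"
      using prod_telescope[of "\<lambda>i. ?D (i * K)" n] by simp
    moreover have "?D K ^ n = (\<Prod>i<n. ?D K)" by simp
    ultimately have prods: "?D (n * K) / ?D K ^ n * (\<Prod>i<n. pochhammer (1 + of_nat i * ?K / 2) (a + b) /
             (pochhammer (1 + of_nat i * ?K / 2) a * pochhammer (1 + of_nat i * ?K / 2) b)) =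
       (\<Prod>i<n. ?D (2 * a + 2 * b + i * K) * ?D ((i + 1) * K) /
               (?D (2 * a + i * K) * ?D (2 * b + i * K) * ?D K))"
      by (simp only: prod_dividef[symmetric] prod.distrib[symmetric])
        (intro prod.cong refl, simp add: field_simps)
    have dn: "?D n = of_nat n * of_int (dfact (int n - 2))"
      using dfact_add2[of "int n - 2"] n by simp
    have aux: "A * (1 / d * (q * B) * PP) = t * N * (1 / (N * d) * (q * PP))"
      if "A * B = t" "N \<noteq> 0" for A B d q t N PP :: complex
      using that by (auto simp: mult_ac)
    have P0: "poly P (0\<^sup>2) = 1 / of_int (dfact (int n - 2))" using P by simp
    have n0: "of_nat n \<noteq> (0 :: complex)" using n by (simp del: of_nat_Suc of_nat_add)
    show ?thesis
      unfolding g_def x0 G log_morris_rhs_def of_int_mult prods[symmetric] dn P0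
      using aux[OF pi_m n0] by (simp only: mult.assoc)
  qed
  show ?thesis
    using lim unfolding lhs rhs .
qed

section \<open>Comparison of the two sides\<close>

text \<open>A pair with signature -1 is expanded in powers of x_j / x_i, so it becomes the arc from
  \<open>j\<close> to \<open>i\<close>.\<close>

definition orient :: "nat \<Rightarrow> nat \<times> nat \<Rightarrow> nat \<times> nat" where
  "orient m s = (if snd s \<le> m + fst s then s else prod.swap s)"

lemma bij_orient: "bij_betw (orient m) (pairs (2 * m + 1)) (arcs m)"
  by (rule bij_betwI[where g = "\<lambda>s. if fst s < snd s then s else prod.swap s"])
    (auto simp: orient_def pairs_def arcs_def split: if_splits)

lemma arcmon_orient:
  "arcmon (orient m (i, j)) = xpow i (sig m i j) * xpow j (- sig m i j)"
  by (simp add: arcmon_def orient_def sig_def mult.commute)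

lemma card_arcs_snd:
  assumes q: "q \<in> {1..2 * m + 1}"
  shows "card {s \<in> arcs m. snd s = q} = m"
proof -
  have "{s \<in> arcs m. snd s = q} = (\<lambda>p. (p, q)) ` ({max 1 (q - m)..<q} \<union> {q + m + 1..2 * m + 1})"
    using q by (auto simp: arcs_def)
  also have "card \<dots> = card ({max 1 (q - m)..<q} \<union> {q + m + 1..2 * m + 1})"
    by (rule card_image) (simp add: inj_on_def)
  also have "\<dots> = card {max 1 (q - m)..<q} + card {q + m + 1..2 * m + 1}"
    by (rule card_Un_disjoint) auto
  also have "\<dots> = m" using q by (auto simp: max_def)
  finally show ?thesis .
qed

lemma card_arcs_fst:
  assumes p: "p \<in> {1..2 * m + 1}"
  shows "card {s \<in> arcs m. fst s = p} = m"
proof -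
  have "{s \<in> arcs m. fst s = p} = (\<lambda>q. (p, q)) ` ({p + 1..min (p + m) (2 * m + 1)} \<union> {1..<p - m})"
    using p by (auto simp: arcs_def)
  also have "card \<dots> = card ({p + 1..min (p + m) (2 * m + 1)} \<union> {1..<p - m})"
    by (rule card_image) (simp add: inj_on_def)
  also have "\<dots> = card {p + 1..min (p + m) (2 * m + 1)} + card {1..<p - m}"
    by (rule card_Un_disjoint) auto
  also have "\<dots> = m" using p by (auto simp: min_def)
  finally show ?thesis .
qed

lemma prod_arcs_snd:
  fixes f :: "nat \<Rightarrow> 'a::comm_monoid_mult"
  shows "(\<Prod>s\<in>arcs m. f (snd s)) = (\<Prod>q=1..2 * m + 1. f q ^ m)"
proof -
  have "(\<Prod>s\<in>arcs m. f (snd s)) = (\<Prod>q=1..2 * m + 1. \<Prod>s | s \<in> arcs m \<and> snd s = q. f (snd s))"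
    by (intro prod.group[symmetric] finite_arcs finite_atLeastAtMost) (auto simp: arcs_def)
  also have "\<dots> = (\<Prod>q=1..2 * m + 1. f q ^ m)"
  proof (rule prod.cong)
    fix q assume q: "q \<in> {1..2 * m + 1}"
    have "(\<Prod>s | s \<in> arcs m \<and> snd s = q. f (snd s)) = (\<Prod>s | s \<in> arcs m \<and> snd s = q. f q)"
      by (rule prod.cong) auto
    then show "(\<Prod>s | s \<in> arcs m \<and> snd s = q. f (snd s)) = f q ^ m"
      using card_arcs_snd[OF q] by simp
  qed simp
  finally show ?thesis .
qed

lemma prod_arcs_fst:
  fixes f :: "nat \<Rightarrow> 'a::comm_monoid_mult"
  shows "(\<Prod>s\<in>arcs m. f (fst s)) = (\<Prod>p=1..2 * m + 1. f p ^ m)"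
proof -
  have "(\<Prod>s\<in>arcs m. f (fst s)) = (\<Prod>p=1..2 * m + 1. \<Prod>s | s \<in> arcs m \<and> fst s = p. f (fst s))"
    by (intro prod.group[symmetric] finite_arcs finite_atLeastAtMost) (auto simp: arcs_def)
  also have "\<dots> = (\<Prod>p=1..2 * m + 1. f p ^ m)"
  proof (rule prod.cong)
    fix p assume p: "p \<in> {1..2 * m + 1}"
    have "(\<Prod>s | s \<in> arcs m \<and> fst s = p. f (fst s)) = (\<Prod>s | s \<in> arcs m \<and> fst s = p. f p)"
      by (rule prod.cong) auto
    then show "(\<Prod>s | s \<in> arcs m \<and> fst s = p. f (fst s)) = f p ^ m"
      using card_arcs_fst[OF p] by simp
  qed simp
  finally show ?thesis .
qed

lemma card_arcs: "card (arcs m) = (2 * m + 1) * m"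
proof -
  have "card (arcs m) = (\<Sum>q=1..2 * m + 1. \<Sum>s | s \<in> arcs m \<and> snd s = q. 1)"
    unfolding card_eq_sum by (intro sum.group[symmetric] finite_arcs finite_atLeastAtMost) (auto simp: arcs_def)
  also have "\<dots> = (\<Sum>q=1..2 * m + 1. m)"
    by (intro sum.cong refl) (simp only: card_arcs_snd flip: card_eq_sum)
  finally show ?thesis by simp
qed

lemma xpow_inverse [simp]: "xpow i 1 * xpow i (- 1) = 1" "xpow i (- 1) * xpow i 1 = 1"
  by (simp_all add: xpow_add)

text \<open>In a regular tournament each variable occurs \<open>m\<close> times upstairs and
  \<open>m\<close> times downstairs.\<close>

lemma prod_arcs_arcmon: "(\<Prod>s\<in>arcs m. arcmon s) = 1"
proof -
  have "(\<Prod>s\<in>arcs m. arcmon s) = (\<Prod>i=1..2 * m + 1. xpow i 1 ^ m) * (\<Prod>i=1..2 * m + 1. xpow i (- 1) ^ m)"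
    unfolding arcmon_def prod.distrib prod_arcs_fst[of "\<lambda>i. xpow i 1"] prod_arcs_snd[of "\<lambda>i. xpow i (- 1)"] ..
  also have "\<dots> = (\<Prod>i=1..2 * m + 1. (xpow i 1 * xpow i (- 1)) ^ m)"
    by (simp only: prod.distrib power_mult_distrib)
  finally show ?thesis by simp
qed

lemma arcmon_swap: "arcmon s * arcmon (prod.swap s) = 1"
proof -
  have "arcmon s * arcmon (prod.swap s) = (xpow (fst s) 1 * xpow (fst s) (- 1)) * (xpow (snd s) 1 * xpow (snd s) (- 1))"
    by (simp only: arcmon_def fst_swap snd_swap mult_ac)
  then show ?thesis by simp
qed

lemma prod_neq_arcs:
  fixes f :: "nat \<times> nat \<Rightarrow> 'a::comm_monoid_mult"
  assumes n: "n = 2 * m + 1"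
  shows "prod f {(i, j). i \<in> {1..n} \<and> j \<in> {1..n} \<and> i \<noteq> j} = (\<Prod>s\<in>arcs m. f s * f (prod.swap s))"
proof -
  have "{(i, j). i \<in> {1..n} \<and> j \<in> {1..n} \<and> i \<noteq> j} = arcs m \<union> prod.swap ` arcs m"
  proof (intro equalityI subsetI)
    fix s assume "s \<in> {(i, j). i \<in> {1..n} \<and> j \<in> {1..n} \<and> i \<noteq> j}"
    then have "s \<in> arcs m \<or> prod.swap s \<in> arcs m" using n by (auto simp: arcs_def)
    then show "s \<in> arcs m \<union> prod.swap ` arcs m" by (metis UnI1 UnI2 imageI swap_swap)
  qed (use n in \<open>auto simp: arcs_def\<close>)
  moreover have "arcs m \<inter> prod.swap ` arcs m = {}" using arcs_opp by auto
  ultimately have "prod f {(i, j). i \<in> {1..n} \<and> j \<in> {1..n} \<and> i \<noteq> j} = prod f (arcs m) * prod f (prod.swap ` arcs m)"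
    by (simp add: prod.union_disjoint)
  also have "prod f (prod.swap ` arcs m) = (\<Prod>s\<in>arcs m. f (prod.swap s))"
    by (subst prod.reindex) (auto simp: inj_on_def)
  finally show ?thesis by (simp add: prod.distrib)
qed

text \<open>Each factor is (x_q - x_p) / x_q. The numerators form the Vandermonde product, with a
  sign for every arc pointing to the larger index; the denominators give the power -m of each
  variable because all in-degrees are \<open>m\<close>.\<close>

lemma prod_one_minus_arcmon:
  assumes n: "n = 2 * m + 1"
  shows "(\<Prod>s\<in>arcs m. 1 - arcmon s) =
    (- 1) ^ card {(i, j) \<in> pairs n. j \<le> m + i} * vandermonde n * (\<Prod>i=1..n. xpow i (- int m))"
proof -
  let ?e = "\<lambda>s. if snd s \<le> m + fst s then - 1 else 1 :: laurent"
  have eq: "1 - arcmon (orient m s) = ?e s * (case s of (i, j) \<Rightarrow> xpow i 1 - xpow j 1) * xpow (snd (orient m s)) (- 1)" for s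
    by (cases s) (auto simp: orient_def arcmon_def algebra_simps)
  have "(\<Prod>s\<in>arcs m. 1 - arcmon s) = (\<Prod>s\<in>pairs n. 1 - arcmon (orient m s))"
    using prod.reindex_bij_betw[OF bij_orient, of "\<lambda>s. 1 - arcmon s"] n by simp
  also have "\<dots> = (\<Prod>s\<in>pairs n. ?e s) * vandermonde n * (\<Prod>s\<in>pairs n. xpow (snd (orient m s)) (- 1))"
    unfolding eq vandermonde_def prod.distrib ..
  also have "(\<Prod>s\<in>pairs n. xpow (snd (orient m s)) (- 1)) = (\<Prod>s\<in>arcs m. xpow (snd s) (- 1))"
    using prod.reindex_bij_betw[OF bij_orient, of "\<lambda>s. xpow (snd s) (- 1)"] n by simp
  also have "\<dots> = (\<Prod>i=1..n. xpow i (- int m))"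
    unfolding prod_arcs_snd[of "\<lambda>i. xpow i (- 1)"] n by (simp add: xpow_power)
  also have "(\<Prod>s\<in>pairs n. ?e s) = (- 1) ^ card (pairs n \<inter> {s. snd s \<le> m + fst s})"
    by (simp add: prod.If_cases)
  also have "pairs n \<inter> {s. snd s \<le> m + fst s} = {(i, j) \<in> pairs n. j \<le> m + i}" by auto
  finally show ?thesis .
qed

text \<open>Since (1 - z)^2 = - z (1 - z) (1 - 1/z) and the product of all \<open>z\<close> is 1,
  the even part 2 k of the exponent yields the symmetric product up to (-1)^(m k). The one factor
  left per arc yields the Vandermonde product.\<close>

lemma morris_factor_times:
  assumes n: "n = 2 * m + 1"
  shows "morris_factor n a b * (\<Prod>s\<in>arcs m. (1 - arcmon s) ^ (2 * k + 1)) =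
    of_int ((- 1) ^ (m * k + card {(i, j) \<in> pairs n. j \<le> m + i})) * logW n m k a b"
proof -
  let ?Q = "{(i, j). i \<in> {1..n} \<and> j \<in> {1..n} \<and> i \<noteq> j}"
  have sq: "(1 - arcmon s) ^ 2 = (- arcmon s) * ((1 - arcmon s) * (1 - arcmon (prod.swap s)))" for s
  proof -
    have "(- arcmon s) * (1 - arcmon (prod.swap s)) = 1 - arcmon s"
      by (simp add: right_diff_distrib arcmon_swap)
    then show ?thesis by (metis power2_eq_square mult.left_commute)
  qed
  have "(\<Prod>s\<in>arcs m. (1 - arcmon s) ^ 2) = (\<Prod>s\<in>arcs m. - arcmon s) * (\<Prod>s\<in>arcs m. (1 - arcmon s) * (1 - arcmon (prod.swap s)))"
    unfolding sq prod.distrib ..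
  also have "(\<Prod>s\<in>arcs m. - arcmon s) = (\<Prod>s\<in>arcs m. - 1) * (\<Prod>s\<in>arcs m. arcmon s)"
    by (simp add: prod_uminus)
  also have "\<dots> = (- 1) ^ m"
    unfolding prod_arcs_arcmon by (simp add: card_arcs power_add power_mult)
  finally have square: "(\<Prod>s\<in>arcs m. (1 - arcmon s) ^ 2) =
      (- 1) ^ m * (\<Prod>s\<in>arcs m. (1 - arcmon s) * (1 - arcmon (prod.swap s)))" .
  have "(\<Prod>s\<in>arcs m. (1 - arcmon s) ^ (2 * k)) = (\<Prod>s\<in>arcs m. (1 - arcmon s) ^ 2) ^ k"
    by (simp only: power_mult prod_power_distrib)
  also have "\<dots> = (- 1) ^ (m * k) * (\<Prod>s\<in>arcs m. (1 - arcmon s) ^ k * (1 - arcmon (prod.swap s)) ^ k)"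
    unfolding square by (simp only: power_mult_distrib prod_power_distrib power_mult)
  also have "(\<Prod>s\<in>arcs m. (1 - arcmon s) ^ k * (1 - arcmon (prod.swap s)) ^ k) = (\<Prod>s\<in>?Q. (1 - arcmon s) ^ k)"
    by (rule prod_neq_arcs[OF n, symmetric])
  also have "\<dots> = (\<Prod>(i, j)\<in>?Q. (1 - xpow i 1 * xpow j (- 1)) ^ k)"
    by (intro prod.cong refl) (auto simp: arcmon_def)
  finally have *: "(\<Prod>s\<in>arcs m. (1 - arcmon s) ^ (2 * k)) =
      (- 1) ^ (m * k) * (\<Prod>(i, j)\<in>?Q. (1 - xpow i 1 * xpow j (- 1)) ^ k)" .
  have W: "logW n m k a b = vandermonde n * ((\<Prod>i=1..n. xpow i (- int m)) * morris_factor n a b) *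
      (\<Prod>(i, j)\<in>?Q. (1 - xpow i 1 * xpow j (- 1)) ^ k)"
    unfolding logW_def morris_factor_def by (simp only: prod.distrib mult.assoc)
  have "(\<Prod>s\<in>arcs m. (1 - arcmon s) ^ (2 * k + 1)) = (\<Prod>s\<in>arcs m. (1 - arcmon s) ^ (2 * k)) * (\<Prod>s\<in>arcs m. 1 - arcmon s)"
    by (simp only: power_add power_one_right prod.distrib)
  then show ?thesis
    unfolding W * prod_one_minus_arcmon[OF n] by (simp add: power_add mult_ac)
qed

text \<open>One count enters through the Vandermonde signs, the other through the inversions of
  \<open>shuffle\<close>; only their sum has to be known.\<close>

lemma card_pairs_split:
  assumes n: "n = 2 * m + 1"
  shows "card {(i, j) \<in> pairs n. j \<le> m + i} + card {(i, j) \<in> pairs n. m + i < j} = n * m"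
proof -
  have "card {(i, j) \<in> pairs n. j \<le> m + i} + card {(i, j) \<in> pairs n. m + i < j} =
      card ({(i, j) \<in> pairs n. j \<le> m + i} \<union> {(i, j) \<in> pairs n. m + i < j})"
    by (rule card_Un_disjoint[symmetric]) (auto intro: finite_subset[OF _ finite_pairs[of n]])
  also have "{(i, j) \<in> pairs n. j \<le> m + i} \<union> {(i, j) \<in> pairs n. m + i < j} = pairs n" by auto
  also have "card (pairs n) = n * m"
    using bij_betw_same_card[OF bij_orient[of m]] card_arcs[of m] n by simp
  finally show ?thesis .
qed

lemma antisymmetric_logW: "antisymmetric n (logW n m k a b)"
  by unfold_locales (rule permute_vars_logW)

text \<open>For 0 < e < 1 the sum at exponent \<open>e\<close> exists for every Laurent polynomial,
  hence so does the one at K + e. This selects the plain branch of \<open>has_CT\<close>, and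
  uniqueness of sums identifies the two values.\<close>

lemma shifted_morris:
  assumes n: "n = 2 * m + 1" and K: "K = 2 * k + 1" and morris: "complex_morris n m P" and e: "0 < e" "e < 1"
  shows "morris_rhs n m P a b (of_nat K + of_real e) =
    of_int ((- 1) ^ (m * k + card {(i, j) \<in> pairs n. j \<le> m + i})) *
    infsum (ct_term (logW n m k a b) (arcs m) (\<lambda>_. one_minus_powr (of_real e)) arcmon) (arcs m \<rightarrow>\<^sub>E UNIV)"
    (is "_ = of_int ?\<sigma> * ?G")
proof -
  let ?u = "of_nat K + of_real e :: complex"
  let ?z = "\<lambda>(i, j). xpow i (sig m i j) * xpow j (- sig m i j)"
  have z: "?z = (\<lambda>s. arcmon (orient m s))" by (auto simp: arcmon_orient)
  have summ: "ct_term L (arcs m) (\<lambda>_. one_minus_powr (of_real e)) arcmon summable_on (arcs m \<rightarrow>\<^sub>E UNIV)" for L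
    by (rule abs_summable_summable[OF ct_term_abs_summable[OF finite_arcs e]])
  have "ct_term (of_int ?\<sigma> * logW n m k a b) (arcs m) (\<lambda>_. one_minus_powr (of_real e)) arcmon =
     (\<lambda>N. of_int ?\<sigma> * ct_term (logW n m k a b) (arcs m) (\<lambda>_. one_minus_powr (of_real e)) arcmon N)"
  proof
    fix N
    have "CT (of_int ?\<sigma> * logW n m k a b * (\<Prod>s\<in>arcs m. arcmon s ^ N s)) =
        of_int ?\<sigma> * CT (logW n m k a b * (\<Prod>s\<in>arcs m. arcmon s ^ N s))"
      unfolding mult.assoc by (rule CT_of_int_mult)
    then show "ct_term (of_int ?\<sigma> * logW n m k a b) (arcs m) (\<lambda>_. one_minus_powr (of_real e)) arcmon N =
        of_int ?\<sigma> * ct_term (logW n m k a b) (arcs m) (\<lambda>_. one_minus_powr (of_real e)) arcmon N"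
      unfolding ct_term_def by (simp only: mult.left_commute)
  qed
  then have "has_CT_sum (morris_factor n a b * (\<Prod>s\<in>arcs m. (1 - arcmon s) ^ K)) (arcs m)
      (\<lambda>_. one_minus_powr (of_real e)) arcmon (of_int ?\<sigma> * ?G)"
    unfolding K morris_factor_times[OF n] has_CT_sum_def
    using has_sum_cmult_right[OF has_sum_infsum[OF summ[of "logW n m k a b"]], of "of_int ?\<sigma>"] by (simp only:)
  then have "has_CT_sum (morris_factor n a b) (arcs m) (\<lambda>_. one_minus_powr ?u) arcmon (of_int ?\<sigma> * ?G)"
    by (rule has_CT_sum_shift[OF finite_arcs summ])
  then have S: "has_CT_sum (morris_factor n a b) (pairs n) (\<lambda>_. one_minus_powr ?u) ?z (of_int ?\<sigma> * ?G)"
    unfolding has_CT_sum_def z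
    using ct_term_reindex[OF bij_orient[of m], of "morris_factor n a b" "\<lambda>_. one_minus_powr ?u" arcmon] n by simp
  have "Re (1 + of_nat n * ?u / 2) > 0"
    using e by (simp add: add_pos_nonneg)
  then have "has_CT (morris_factor n a b) (pairs n) (\<lambda>_. one_minus_powr ?u) ?z (morris_rhs n m P a b ?u)"
    unfolding morris_rhs_def by (rule morris[unfolded complex_morris_def, rule_format])
  moreover have "(\<lambda>N. norm (ct_term (morris_factor n a b) (pairs n) (\<lambda>_. one_minus_powr ?u) ?z N))
      summable_on (pairs n \<rightarrow>\<^sub>E UNIV)"
    using S unfolding has_CT_sum_def summable_on_iff_abs_summable_on_complex[symmetric] by (rule has_sum_imp_summable)
  ultimately have "has_CT_sum (morris_factor n a b) (pairs n) (\<lambda>_. one_minus_powr ?u) ?z (morris_rhs n m P a b ?u)"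
    unfolding has_CT_def by (rule iffD1[OF if_P, rotated])
  then show ?thesis
    using S unfolding has_CT_sum_def by (rule has_sum_unique)
qed

theorem theorem1p3:
  fixes n m k K a b :: nat
  assumes "odd n"
    and "m = (n - 1) div 2"
    and "\<exists>P :: complex poly. poly P 0 = 1 / of_int (dfact (int n - 2)) \<and> poly P 1 = 1 \<and>
           complex_morris n m P"
    and "K = 2 * k + 1"
  shows "has_CT_sum
           (vandermonde n *
            (\<Prod>i=1..n. xpow i (- int m) * (1 - xpow i 1) ^ a * (1 - xpow i (- 1)) ^ b) *
            (\<Prod>(i, j) | i \<in> {1..n} \<and> j \<in> {1..n} \<and> i \<noteq> j. (1 - xpow i 1 * xpow j (- 1)) ^ k))
           {1..m} (\<lambda>_. log_one_minus) (\<lambda>i. xpow (2 * i) 1 * xpow (2 * i - 1) (- 1))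
           (1 / of_int (dfact (int n)) *
            (\<Prod>i<n. of_int (dfact (int (2 * a + 2 * b + i * K)) * dfact (int ((i + 1) * K))) /
               of_int (dfact (int (2 * a + i * K)) * dfact (int (2 * b + i * K)) * dfact (int K))))"
proof -
  have n: "n = 2 * m + 1" using assms(1,2) by (auto elim: oddE)
  obtain P :: "complex poly" where P: "poly P 0 = 1 / of_int (dfact (int n - 2))" "complex_morris n m P"
    using assms(3) by blast
  interpret antisymmetric n "logW n m k a b" by (rule antisymmetric_logW)
  let ?A = "(\<lambda>i. (2 * i, 2 * i - 1)) ` {1..m}"
  let ?\<mu> = "card {(i, j) \<in> pairs n. j \<le> m + i}" and ?\<nu> = "card {(i, j) \<in> pairs n. m + i < j}"
  let ?G = "\<lambda>e. infsum (ct_term (logW n m k a b) (arcs m) (\<lambda>_. one_minus_powr (of_real e)) arcmon) (arcs m \<rightarrow>\<^sub>E UNIV)"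
  let ?s = "(- 1) ^ (m * k + ?\<mu>) :: complex"
  have np: "{E. E \<subseteq> arcs m \<and> matching E \<and> card E = m} = near_perfect m" by (simp add: near_perfect_def)
  have "((\<lambda>e. ?G e / of_real e ^ m) \<longlongrightarrow> (\<Sum>E | E \<subseteq> arcs m \<and> matching E \<and> card E = m. logCT E)) (at_right 0)"
    by (rule shifted_limit[OF finite_arcs n]) (use arcs_subset n in \<open>auto dest: arcs_loop arcs_opp\<close>)
  then have "((\<lambda>e. ?G e / of_real e ^ m) \<longlongrightarrow> of_nat n * ((- 1) ^ ?\<nu> * logCT ?A)) (at_right 0)"
    unfolding np sum_near_perfect[OF n] logCT_shuffle[OF n] .
  then have 1: "((\<lambda>e. ?s * (?G e / of_real e ^ m)) \<longlongrightarrow> ?s * (of_nat n * ((- 1) ^ ?\<nu> * logCT ?A))) (at_right 0)"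
    by (rule tendsto_mult_left)
  have "\<forall>\<^sub>F e in at_right 0. morris_rhs n m P a b (of_nat K + of_real e) / of_real e ^ m = ?s * (?G e / of_real e ^ m)"
    using shifted_morris[OF n assms(4) P(2)] unfolding eventually_at_right_field
    by (intro exI[of _ 1]) simp
  with morris_rhs_limit[OF n P(1) assms(4)]
  have 2: "((\<lambda>e. ?s * (?G e / of_real e ^ m)) \<longlongrightarrow> (- 1) ^ (m * (k + 1)) * of_nat n * log_morris_rhs n K a b) (at_right 0)"
    by (rule Lim_transform_eventually)
  have "?s * (of_nat n * ((- 1) ^ ?\<nu> * logCT ?A)) = (- 1) ^ (m * (k + 1)) * of_nat n * log_morris_rhs n K a b"
    by (rule tendsto_unique[OF _ 1 2]) simp
  then have "of_nat n * ((- 1) ^ (m * k + (?\<mu> + ?\<nu>)) * logCT ?A) = of_nat n * ((- 1) ^ (m * (k + 1)) * log_morris_rhs n K a b)"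
    by (simp only: power_add mult_ac)
  moreover have "(- 1) ^ (m * k + (?\<mu> + ?\<nu>)) = ((- 1) ^ (m * (k + 1)) :: complex)"
  proof -
    \<comment> \<open>As n = 2 m + 1, the exponents m k + n m and m (k + 1) have the same
      parity.\<close>
    have "m * k + n * m = m * (k + 1) + 2 * (m * m)" by (simp add: n algebra_simps)
    then show ?thesis unfolding card_pairs_split[OF n] by (simp only: power_add) (simp add: minus_one_power_iff)
  qed
  moreover have "of_nat n \<noteq> (0 :: complex)" using assms(1) by (auto intro: Nat.gr0I)
  ultimately have logCT: "logCT ?A = log_morris_rhs n K a b" by simp
  \<comment> \<open>The value of \<open>logCT\<close> is only that of an \<open>infsum\<close>.
    Convergence is added here: the arcs form a matching, so the sum has finitely many nonzero
    terms.\<close>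
  have "matching ?A" by (auto simp: matching_def)
  then have "arc_independent ?A" by (intro arc_independent_matching) auto
  then have H: "(ct_term (logW n m k a b) ?A (\<lambda>_. log_one_minus) arcmon has_sum
      (\<Sum>M | M \<in> support_class ?A ?A \<and> Poly_Mapping.lookup (logW n m k a b) (- arc_exponent ?A M) \<noteq> 0.
        ct_term (logW n m k a b) ?A (\<lambda>_. log_one_minus) arcmon M)) (?A \<rightarrow>\<^sub>E UNIV)"
    by (intro has_sum_log) auto
  then have "(ct_term (logW n m k a b) ?A (\<lambda>_. log_one_minus) arcmon has_sum logCT ?A) (?A \<rightarrow>\<^sub>E UNIV)"
    unfolding logCT_def infsumI[OF H] .
  moreover have "bij_betw (\<lambda>i. (2 * i, 2 * i - 1)) {1..m} ?A"
    by (intro inj_on_imp_bij_betw) (auto simp: inj_on_def)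
  ultimately have "(ct_term (logW n m k a b) {1..m} (\<lambda>_. log_one_minus) (\<lambda>i. arcmon (2 * i, 2 * i - 1)) has_sum logCT ?A) ({1..m} \<rightarrow>\<^sub>E UNIV)"
    using ct_term_reindex[of "\<lambda>i. (2 * i, 2 * i - 1)" "{1..m}" ?A "logW n m k a b" "\<lambda>_. log_one_minus" arcmon] by blast
  then show ?thesis
    unfolding logCT unfolding has_CT_sum_def log_morris_rhs_def logW_def arcmon_def by simp
qed

end
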